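(* Let $X$ be a locally compact (Hausdorff) topological group and $Y$ be any topological group. Every Haar-measurable homomorphism $h:X\to Y$ is continuous.
   Context: A function $f:X\to Y$ from a locally compact topological group $X$ to a topological space $Y$ is Haar-measurable if for every open set $U\subseteq Y$ the preimage $f^{-1}[U]$ belongs to the $\sigma$-algebra of sets measurable with respect to a Haar measure on $X$ (i.e. to the $\sigma$-algebra generated by the Borel sets and the Haar-null sets, where a set is Haar-null if it is contained in a Borel set of Haar measure zero). All topological spaces are Hausdorff. *)

theory Defs
  imports "HOL-Analysis.Analysis" "HOL-Algebra.Group"
begin

definition topological_group :: "('a, 'm) monoid_scheme \<Rightarrow> 'a topology \<Rightarrow> bool" where
  "topological_group G T \<longleftrightarrow>
     group G \<and> topspace T = carrier G \<and> Hausdorff_space T \<and>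
     continuous_map (prod_topology T T) T (\<lambda>(x, y). x \<otimes>\<^bsub>G\<^esub> y) \<and>
     continuous_map T T (\<lambda>x. inv\<^bsub>G\<^esub> x)"

definition borel_sets_of :: "'a topology \<Rightarrow> 'a set set" where
  "borel_sets_of T = sigma_sets (topspace T) {U. openin T U}"

definition haar_measure :: "('a, 'm) monoid_scheme \<Rightarrow> 'a topology \<Rightarrow> 'a measure \<Rightarrow> bool" where
  "haar_measure G T M \<longleftrightarrow>
     space M = topspace T \<and> sets M = borel_sets_of T \<and>
     (\<forall>K. compactin T K \<longrightarrow> emeasure M K < \<infinity>) \<and>
     (\<forall>A\<in>sets M. emeasure M A = (INF U\<in>{U. openin T U \<and> A \<subseteq> U}. emeasure M U)) \<and>
     (\<forall>U. openin T U \<longrightarrow> emeasure M U = (SUP K\<in>{K. compactin T K \<and> K \<subseteq> U}. emeasure M K)) \<and>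
     emeasure M (topspace T) \<noteq> 0 \<and>
     (\<forall>g\<in>carrier G. \<forall>A\<in>sets M.
        (\<lambda>x. g \<otimes>\<^bsub>G\<^esub> x) ` A \<in> sets M \<and> emeasure M ((\<lambda>x. g \<otimes>\<^bsub>G\<^esub> x) ` A) = emeasure M A)"

definition haar_null :: "'a topology \<Rightarrow> 'a measure \<Rightarrow> 'a set \<Rightarrow> bool" where
  "haar_null T M N \<longleftrightarrow> (\<exists>B\<in>borel_sets_of T. N \<subseteq> B \<and> emeasure M B = 0)"

definition haar_measurable_sets :: "'a topology \<Rightarrow> 'a measure \<Rightarrow> 'a set set" where
  "haar_measurable_sets T M =
     sigma_sets (topspace T) (borel_sets_of T \<union> {N. N \<subseteq> topspace T \<and> haar_null T M N})"

definition haar_measurable_fun ::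
    "'a topology \<Rightarrow> 'a measure \<Rightarrow> 'b topology \<Rightarrow> ('a \<Rightarrow> 'b) \<Rightarrow> bool" where
  "haar_measurable_fun T M S f \<longleftrightarrow>
     (\<forall>U. openin S U \<longrightarrow> {x \<in> topspace T. f x \<in> U} \<in> haar_measurable_sets T M)"

end

(* No countability is available in the target, so one cannot argue with a countable cover by
   translates.  Let W n be a sequence of symmetric neighbourhoods of 1 in the target with
   W (n+1) W (n+1) inside W n, and P n the preimage of W n.  By Steinhaus it is enough that P 0 is
   not null, and one may work in an open sigma-compact subgroup.  If P 0 is null, then so is P 0 K
   for some compact normal K such that the K-saturated open sets have a countable base: this holds
   because compact sets all of whose nonempty relatively open subsets have positive measure are
   exactly invariant under K as soon as K moves them by null sets only.  As in Stone's theorem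
   that metric spaces are paracompact, the sets P n K yield countably many disjoint families of
   null sets that cover the group and have measurable subunions.  A Fubini argument along a
   well-order of the index set shows that each family has a null union, so the group is null. *)
theory Submission
  imports Defs "HOL-Algebra.Coset"
begin

text \<open>The obstacle is set-theoretic. A disjoint family of null sets with measurable subunions
  pushes the measure forward to a measure on all subsets of the index set that vanishes at points.
  Such measures cannot be excluded outright: a real-valued measurable cardinal carries one. So the
  contradiction needs small open covers of the initial segments that are built from one fixed
  countable collection; then the set of pairs in Fubini's theorem is a countable union of
  rectangles. Outer regularity supplies small open sets, but a nonmetrizable group has no countable
  base to build them from. Passing from P n to P n K repairs this: the sets in question become
  unions of cosets of K, and around such cosets countably many open sets suffice. The price is that
  P 0 K must still be null although K may be uncountable, so K is chosen after P 0, as in the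
  Kakutani-Kodaira theorem but adapted to countably many compact sets. Arbitrary subunions are
  measurable because any union of translates of P n is the preimage of an open set.\<close>

section \<open>Unions of null sets\<close>

text \<open>If some proper initial segment of \<open>I\<close> has a non-null union,
  \<open>J\<close> is the shortest such segment; otherwise \<open>J\<close> is
  \<open>I\<close>.\<close>

lemma exists_nonnull_union_null_initial_segments:
  fixes A :: "'i \<Rightarrow> 'a set"
  assumes nonnull: "(\<Union>i\<in>I. A i) \<notin> null_sets N"
  obtains lt :: "'i \<Rightarrow> 'i \<Rightarrow> bool" and J where
    "\<And>i j. lt i j \<or> i = j \<or> lt j i" "J \<subseteq> I" "(\<Union>i\<in>J. A i) \<notin> null_sets N"
    "\<And>i. i \<in> J \<Longrightarrow> (\<Union>j\<in>{j \<in> J. lt j i}. A j) \<in> null_sets N"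
proof -
  obtain r :: "'i rel" where r: "well_order_on UNIV r"
    using well_order_on by blast
  define lt where "lt i j \<longleftrightarrow> (i, j) \<in> r - Id" for i j
  have wf: "wfP lt"
  proof -
    have "{(x, y). lt x y} = r - Id"
      by (auto simp: lt_def)
    then show ?thesis
      using r by (simp add: well_order_on_def wfp_def)
  qed
  have lin: "linear_order_on UNIV r"
    using r by (simp add: well_order_on_def)
  have tot: "lt i j \<or> i = j \<or> lt j i" for i j
    using lin by (auto simp: linear_order_on_def total_on_def lt_def)
  have trans: "lt i j \<Longrightarrow> lt j k \<Longrightarrow> lt i k" for i j k
    using lin by (auto simp: linear_order_on_def partial_order_on_def preorder_on_def lt_def
        dest: transD antisymD)
  define bad where "bad = {i \<in> I. (\<Union>j\<in>{j \<in> I. lt j i}. A j) \<notin> null_sets N}"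
  show thesis
  proof (cases "bad = {}")
    case True
    then show thesis
      using that[OF tot subset_refl nonnull] by (auto simp: bad_def)
  next
    case False
    then obtain i0 where "i0 \<in> bad" by blast
    from wfE_min[OF wf[unfolded wfp_def] this]
    obtain i where i: "i \<in> bad" and min: "\<And>j. lt j i \<Longrightarrow> j \<notin> bad"
      by auto
    show thesis
    proof (rule that[OF tot, of "{j \<in> I. lt j i}"])
      fix k assume k: "k \<in> {j \<in> I. lt j i}"
      then have "{j \<in> {j \<in> I. lt j i}. lt j k} = {j \<in> I. lt j k}"
        using trans by blast
      with k min[of k] show "(\<Union>j\<in>{j \<in> {j \<in> I. lt j i}. lt j k}. A j) \<in> null_sets N"
        by (simp add: bad_def)
    qed (use i in \<open>auto simp: bad_def\<close>)
  qed
qed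

text \<open>After passing to an index set \<open>J\<close> with null initial segments, choose small \<open>U i\<close> that are
  unions of members of \<open>\<B>\<close> and contain the initial segment up to \<open>i\<close>. Since \<open>\<B>\<close> is countable, the set of
  pairs \<open>(x, i)\<close> with \<open>x \<in> U i\<close> is product measurable for the push-forward measure on all subsets of
  \<open>J\<close>: its horizontal sections are small, its vertical sections are conull.\<close>

lemma null_Union_of_measurable_subunions:
  fixes A :: "'i \<Rightarrow> 'a set"
  assumes "sigma_finite_measure N" "countable \<B>" "\<B> \<subseteq> sets N"
    and disj: "disjoint_family_on A I"
    and meas: "\<And>J. J \<subseteq> I \<Longrightarrow> (\<Union>i\<in>J. A i) \<in> sets N"
    and null: "\<And>i. i \<in> I \<Longrightarrow> A i \<in> null_sets N"
    and cover: "\<And>J e. J \<subseteq> I \<Longrightarrow> (\<Union>i\<in>J. A i) \<in> null_sets N \<Longrightarrow> 0 < e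
      \<Longrightarrow> \<exists>\<C>\<subseteq>\<B>. (\<Union>i\<in>J. A i) \<subseteq> \<Union>\<C> \<and> emeasure N (\<Union>\<C>) < e"
  shows "(\<Union>i\<in>I. A i) \<in> null_sets N"
proof (rule ccontr)
  interpret N: sigma_finite_measure N by fact
  assume "(\<Union>i\<in>I. A i) \<notin> null_sets N"
  then obtain lt J where tot: "\<And>i j. lt i j \<or> i = j \<or> lt j i" and JI: "J \<subseteq> I"
    and J: "(\<Union>i\<in>J. A i) \<notin> null_sets N"
    and seg: "\<And>i. i \<in> J \<Longrightarrow> (\<Union>j\<in>{j \<in> J. lt j i}. A j) \<in> null_sets N"
    by (rule exists_nonnull_union_null_initial_segments) blast
  define S where "S = (\<Union>i\<in>J. A i)"
  have S: "S \<in> sets N"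
    using meas[OF JI] by (simp add: S_def)
  obtain F :: "nat \<Rightarrow> 'a set" where F: "range F \<subseteq> sets N" "(\<Union>n. F n) = space N"
    "\<And>n. emeasure N (F n) \<noteq> \<infinity>"
    using N.sigma_finite by blast
  have "\<exists>n. emeasure N (S \<inter> F n) \<noteq> 0"
  proof (rule ccontr)
    assume "\<not> ?thesis"
    then have "(\<Union>n. S \<inter> F n) \<in> null_sets N"
      using S F(1) by (intro null_sets_UN) (auto simp: null_sets_def)
    moreover have "(\<Union>n. S \<inter> F n) = S"
      using F(2) sets.sets_into_space[OF S] by auto
    ultimately show False
      using J S_def by simp
  qed
  then obtain n where n: "emeasure N (S \<inter> F n) \<noteq> 0" by blast
  \<comment> \<open>A piece of finite positive measure is enough; finiteness is what makes
    \<open>c / 2 < c\<close>.\<close>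
  define D where "D = S \<inter> F n"
  have D: "D \<in> sets N" "D \<subseteq> S" "emeasure N D \<noteq> 0"
    using S F(1) n by (auto simp: D_def)
  have Dfin: "emeasure N D \<noteq> \<infinity>"
  proof -
    have "emeasure N D \<le> emeasure N (F n)"
      using F(1) by (intro emeasure_mono) (auto simp: D_def)
    then show ?thesis
      using F(3)[of n] by (auto simp: top_unique)
  qed
  define c where "c = emeasure N D"
  have c: "0 < c" "c < \<infinity>"
    using D(3) Dfin by (auto simp: c_def zero_less_iff_neq_zero less_top)
  define M1 where "M1 = restrict_space N D"
  have sp1: "space M1 = D"
    using sets.sets_into_space[OF D(1)] by (auto simp: M1_def space_restrict_space)
  have s1: "X \<in> sets N \<Longrightarrow> X \<inter> D \<in> sets M1" for X
    by (auto simp: M1_def sets_restrict_space)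
  have em1: "X \<subseteq> D \<Longrightarrow> emeasure M1 X = emeasure N X" for X
    using D(1) sets.sets_into_space[OF D(1)]
    by (simp add: M1_def emeasure_restrict_space Int_absorb2)
  interpret M1: finite_measure M1
    by standard (simp add: sp1 em1 Dfin flip: infinity_ennreal_def)
  define f where "f x = (THE i. i \<in> J \<and> x \<in> A i)" for x
  have f_eq: "f x = i" if "i \<in> J" "x \<in> A i" for i x
    unfolding f_def
  proof (rule the_equality)
    show "\<And>j. j \<in> J \<and> x \<in> A j \<Longrightarrow> j = i"
      using that disj JI by (auto simp: disjoint_family_on_def)
  qed (use that in simp)
  have f_in: "f x \<in> J \<and> x \<in> A (f x)" if "x \<in> D" for x
    using that D(2) f_eq unfolding S_def by blast
  have pre: "f -` K \<inter> D = (\<Union>i\<in>J \<inter> K. A i) \<inter> D" for K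
    using f_in f_eq by auto
  have f_meas: "f \<in> measurable M1 (count_space UNIV)"
  proof (rule measurableI)
    fix K
    show "f -` K \<inter> space M1 \<in> sets M1"
      unfolding sp1 pre using JI by (intro s1 meas) auto
  qed simp
  \<comment> \<open>Every set of indices is measurable here, since its preimage under
    \<open>f\<close> is a subunion cut down to \<open>D\<close>.\<close>
  define nu where "nu = distr M1 (count_space UNIV) f"
  have nu: "emeasure nu K = emeasure N ((\<Union>i\<in>J \<inter> K. A i) \<inter> D)" for K
    unfolding nu_def
    by (subst emeasure_distr[OF f_meas]) (auto simp: sp1 pre em1)
  have snu [simp]: "sets nu = UNIV" "space nu = UNIV"
    by (auto simp: nu_def)
  interpret nu: finite_measure nu
    unfolding nu_def by (rule M1.finite_measure_distr[OF f_meas])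
  interpret P: pair_sigma_finite M1 nu ..
  have c2: "0 < c / 2" "c / 2 < c"
  proof -
    obtain r where r: "c = ennreal r" "0 < r"
      using c by (cases c) auto
    then have "c / 2 = ennreal (r / 2)"
      by (simp add: ennreal_divide_numeral)
    with r show "0 < c / 2" "c / 2 < c"
      by (simp_all add: ennreal_less_iff)
  qed
  have "\<exists>\<C>. \<C> \<subseteq> \<B> \<and> (\<Union>j\<in>{j \<in> J. lt j i \<or> j = i}. A j) \<subseteq> \<Union>\<C> \<and> emeasure N (\<Union>\<C>) < c / 2"
    if "i \<in> J" for i
  proof -
    have "(\<Union>j\<in>{j \<in> J. lt j i \<or> j = i}. A j) \<in> null_sets N"
    proof -
      have "(\<Union>j\<in>{j \<in> J. lt j i \<or> j = i}. A j) = (\<Union>j\<in>{j \<in> J. lt j i}. A j) \<union> A i"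
        using that by auto
      then show ?thesis
        using null_sets.Un[OF seg[OF that] null[of i]] that JI by auto
    qed
    then show ?thesis
      using cover[OF _ _ c2(1), of "{j \<in> J. lt j i \<or> j = i}"] JI by auto
  qed
  then have "\<forall>i\<in>J. \<exists>\<C>. \<C> \<subseteq> \<B> \<and> (\<Union>j\<in>{j \<in> J. lt j i \<or> j = i}. A j) \<subseteq> \<Union>\<C> \<and> emeasure N (\<Union>\<C>) < c / 2"
    by blast
  from bchoice[OF this] obtain \<C> where \<C>0: "\<forall>i\<in>J. \<C> i \<subseteq> \<B> \<and>
      (\<Union>j\<in>{j \<in> J. lt j i \<or> j = i}. A j) \<subseteq> \<Union>(\<C> i) \<and> emeasure N (\<Union>(\<C> i)) < c / 2"
    by blast
  then have \<C>: "\<And>i. i \<in> J \<Longrightarrow> \<C> i \<subseteq> \<B>"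
    "\<And>i. i \<in> J \<Longrightarrow> (\<Union>j\<in>{j \<in> J. lt j i \<or> j = i}. A j) \<subseteq> \<Union>(\<C> i)"
    "\<And>i. i \<in> J \<Longrightarrow> emeasure N (\<Union>(\<C> i)) < c / 2"
    by blast+
  \<comment> \<open>Grouping the pairs by the member \<open>V\<close> of \<open>\<B>\<close> that
    contains \<open>x\<close> gives countably many rectangles, whose second sides may be arbitrary
    sets of indices.\<close>
  define E where "E = (\<Union>V\<in>\<B>. (V \<inter> D) \<times> {i \<in> J. V \<in> \<C> i})"
  have E: "E \<in> sets (M1 \<Otimes>\<^sub>M nu)"
    unfolding E_def using assms(2,3) s1
    by (intro sets.countable_UN'' pair_measureI) auto
  \<comment> \<open>The two orders of integration give incompatible values: at least
    \<open>c * c\<close> by vertical sections, at most \<open>c / 2 * c\<close> by horizontal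
    ones.\<close>
  have "c * c \<le> (\<integral>\<^sup>+x. c \<partial>M1)"
    by (simp add: sp1 em1 c_def)
  also have "\<dots> \<le> (\<integral>\<^sup>+x. emeasure nu (Pair x -` E) \<partial>M1)"
  proof (intro nn_integral_mono)
    fix x assume "x \<in> space M1"
    then have x: "x \<in> D" "f x \<in> J" "x \<in> A (f x)"
      using f_in sp1 by auto
    \<comment> \<open>Only indices before \<open>f x\<close> can be missing from the section over
      \<open>x\<close>, because \<open>\<C> i\<close> covers \<open>A (f x)\<close> for all others;
      and these earlier indices form a null initial segment.\<close>
    let ?Z = "{i. lt i (f x)}"
    have "J - ?Z \<subseteq> Pair x -` E"
    proof
      fix i assume "i \<in> J - ?Z"
      then have i: "i \<in> J" "lt (f x) i \<or> f x = i"
        using tot by auto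
      then have "x \<in> \<Union>(\<C> i)"
        using x \<C>(2)[of i] by auto
      then show "i \<in> Pair x -` E"
        using \<C>(1)[of i] x(1) i(1) by (auto simp: E_def)
    qed
    have "J \<inter> ?Z = {j \<in> J. lt j (f x)}" by auto
    then have "(\<Union>i\<in>J \<inter> ?Z. A i) \<inter> D \<in> null_sets N"
      by (metis null_set_Int2 seg[OF x(2)] D(1))
    then have Z: "emeasure nu ?Z = 0"
      by (simp add: nu null_setsD1)
    have "c = emeasure nu J"
      using D(2) by (simp add: nu c_def S_def Int_absorb1)
    also have "\<dots> \<le> emeasure nu ((J - ?Z) \<union> ?Z)"
      by (intro emeasure_mono) auto
    also have "\<dots> \<le> emeasure nu (J - ?Z) + emeasure nu ?Z"
      by (intro emeasure_subadditive) auto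
    also have "\<dots> \<le> emeasure nu (Pair x -` E)"
      using Z \<open>J - ?Z \<subseteq> Pair x -` E\<close> by (simp add: emeasure_mono)
    finally show "c \<le> emeasure nu (Pair x -` E)" .
  qed
  also have "\<dots> = emeasure (M1 \<Otimes>\<^sub>M nu) E"
    by (rule nu.emeasure_pair_measure_alt[OF E, symmetric])
  also have "\<dots> = (\<integral>\<^sup>+i. emeasure M1 ((\<lambda>x. (x, i)) -` E) \<partial>nu)"
    by (rule P.emeasure_pair_measure_alt2[OF E])
  also have "\<dots> \<le> (\<integral>\<^sup>+i. c / 2 \<partial>nu)"
  proof (intro nn_integral_mono)
    fix i
    show "emeasure M1 ((\<lambda>x. (x, i)) -` E) \<le> c / 2"
    proof (cases "i \<in> J")
      case True
      have "\<Union>(\<C> i) \<in> sets N"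
        using \<C>(1)[OF True] assms(2,3) by (intro sets.countable_Union) (auto dest: countable_subset)
      moreover have sub: "(\<lambda>x. (x, i)) -` E \<subseteq> \<Union>(\<C> i) \<inter> D"
        by (auto simp: E_def)
      ultimately have "emeasure N ((\<lambda>x. (x, i)) -` E) \<le> emeasure N (\<Union>(\<C> i))"
        by (intro emeasure_mono) auto
      also have "\<dots> \<le> c / 2"
        using \<C>(3)[OF True] by simp
      finally show ?thesis
        using sub by (subst em1) auto
    next
      case False
      then have "(\<lambda>x. (x, i)) -` E = {}"
        by (auto simp: E_def)
      then show ?thesis by simp
    qed
  qed
  also have "\<dots> = c / 2 * c"
    using D(2) by (simp add: nu c_def S_def Int_absorb1)
  also have "\<dots> < c * c"
    using c c2 by (metis ennreal_mult_strict_right_mono infinity_ennreal_def)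
  finally show False by simp
qed

section \<open>Topological groups\<close>

locale top_group = group G for G :: "('a, 'm) monoid_scheme" (structure) +
  fixes T :: "'a topology"
  assumes topological_group: "topological_group G T"

lemma top_group_if_topological_group: "topological_group G T \<Longrightarrow> top_group G T"
  by (simp add: top_group_def top_group_axioms_def topological_group_def)

context top_group
begin

lemma topspace_eq [simp]: "topspace T = carrier G"
  and Hausdorff: "Hausdorff_space T"
  using topological_group by (simp_all add: topological_group_def)

lemma openin_subset_carrier: "openin T U \<Longrightarrow> U \<subseteq> carrier G"
  using openin_subset[of T U] by simp

lemma compactin_subset_carrier: "compactin T C \<Longrightarrow> C \<subseteq> carrier G"
  using compactin_subset_topspace[of T C] by simp

section \<open>Continuity of the operations, and neighbourhoods that are uniform over compact
  sets\<close>

lemma continuous_map_idI: "continuous_map T T (\<lambda>x. x)"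
  using continuous_map_id[of T] by (simp add: id_def)

lemma continuous_map_mult:
  assumes "continuous_map Z T f" "continuous_map Z T g"
  shows "continuous_map Z T (\<lambda>z. f z \<otimes> g z)"
proof -
  have "continuous_map Z (prod_topology T T) (\<lambda>z. (f z, g z))"
    using assms by (simp add: continuous_map_paired)
  moreover have "continuous_map (prod_topology T T) T (\<lambda>(x, y). x \<otimes> y)"
    using topological_group by (simp add: topological_group_def)
  ultimately have "continuous_map Z T ((\<lambda>(x, y). x \<otimes> y) \<circ> (\<lambda>z. (f z, g z)))"
    by (rule continuous_map_compose)
  then show ?thesis by (simp add: o_def)
qed

lemma continuous_map_m_inv:
  assumes "continuous_map Z T f"
  shows "continuous_map Z T (\<lambda>z. inv (f z))"
proof -
  have "continuous_map T T (\<lambda>x. inv x)"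
    using topological_group by (simp add: topological_group_def)
  from continuous_map_compose[OF assms this] show ?thesis by (simp add: o_def)
qed

lemma continuous_map_mult_const: "g \<in> carrier G \<Longrightarrow> continuous_map T T (\<lambda>x. g \<otimes> x)"
  by (intro continuous_map_mult continuous_map_idI) auto

lemma openin_mult_preimage:
  assumes "g \<in> carrier G" "openin T U"
  shows "openin T {x \<in> carrier G. g \<otimes> x \<in> U}"
  using openin_continuous_map_preimage[OF continuous_map_mult_const[OF assms(1)] assms(2)] by simp

lemma mult_image_eq:
  assumes "g \<in> carrier G" "U \<subseteq> carrier G"
  shows "(\<lambda>x. g \<otimes> x) ` U = {x \<in> carrier G. inv g \<otimes> x \<in> U}"
proof -
  have "x \<in> (\<lambda>x. g \<otimes> x) ` U" if "x \<in> carrier G" "inv g \<otimes> x \<in> U" for x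
    using that assms by (intro image_eqI[of _ _ "inv g \<otimes> x"]) (auto simp flip: m_assoc)
  moreover have "inv g \<otimes> (g \<otimes> x) \<in> U" if "x \<in> U" for x
    using that assms by (auto simp flip: m_assoc)
  ultimately show ?thesis
    using assms by auto
qed

lemma openin_mult_image:
  assumes "g \<in> carrier G" "openin T U"
  shows "openin T ((\<lambda>x. g \<otimes> x) ` U)"
  using openin_mult_preimage[of "inv g" U] assms openin_subset_carrier
  by (simp add: mult_image_eq)

text \<open>Wallace's theorem for the compact rectangle {1} x \<open>C\<close>: the first side of
  the open rectangle that it yields works for all of \<open>C\<close> at once.\<close>

lemma tube:
  assumes F: "continuous_map (prod_topology T T) T (\<lambda>(v, x). F v x)"
    and "compactin T C" "openin T O'" "\<And>x. x \<in> C \<Longrightarrow> F \<one> x \<in> O'"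
  obtains V where "openin T V" "\<one> \<in> V" "\<And>v x. v \<in> V \<Longrightarrow> x \<in> C \<Longrightarrow> F v x \<in> O'"
proof -
  let ?W = "{z \<in> topspace (prod_topology T T). (\<lambda>(v, x). F v x) z \<in> O'}"
  have W: "openin (prod_topology T T) ?W"
    by (rule openin_continuous_map_preimage[OF F assms(3)])
  have "{\<one>} \<times> C \<subseteq> ?W"
    using assms(4) compactin_subset_carrier[OF assms(2)] by auto
  moreover have "compactin T {\<one>}" by simp
  ultimately obtain U V where "openin T U" "openin T V" "{\<one>} \<subseteq> U" "C \<subseteq> V" "U \<times> V \<subseteq> ?W"
    using Wallace_theorem_prod_topology[OF _ assms(2) W] by blast
  note UV = this
  show thesis
  proof (rule that[of U])
    fix v x assume "v \<in> U" "x \<in> C"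
    then have "(v, x) \<in> ?W"
      using UV(4,5) by blast
    then show "F v x \<in> O'" by simp
  qed (use UV in auto)
qed

lemma conj_tube:
  assumes "compactin T C" "openin T U" "\<one> \<in> U"
  obtains V where "openin T V" "\<one> \<in> V" "\<And>v x. v \<in> V \<Longrightarrow> x \<in> C \<Longrightarrow> inv x \<otimes> v \<otimes> x \<in> U"
proof (rule tube[of "\<lambda>v x. inv x \<otimes> v \<otimes> x" C U])
  show "continuous_map (prod_topology T T) T (\<lambda>(v, x). inv x \<otimes> v \<otimes> x)"
    unfolding case_prod_beta
    by (intro continuous_map_mult continuous_map_m_inv continuous_map_fst continuous_map_snd)
  show "inv x \<otimes> \<one> \<otimes> x \<in> U" if "x \<in> C" for x
    using that assms(3) compactin_subset_carrier[OF assms(1)] by auto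
qed (use assms that in auto)

lemma mult_tube:
  assumes "compactin T C" "openin T U" "C \<subseteq> U"
  obtains V where "openin T V" "\<one> \<in> V" "\<And>v x. v \<in> V \<Longrightarrow> x \<in> C \<Longrightarrow> v \<otimes> x \<in> U"
proof (rule tube[of "\<lambda>v x. v \<otimes> x" C U])
  show "continuous_map (prod_topology T T) T (\<lambda>(v, x). v \<otimes> x)"
    unfolding case_prod_beta
    by (intro continuous_map_mult continuous_map_fst continuous_map_snd)
  show "\<one> \<otimes> x \<in> U" if "x \<in> C" for x
    using that assms(3) compactin_subset_carrier[OF assms(1)] by (metis l_one subsetD)
qed (use assms that in auto)

lemma square_nbhd:
  assumes "openin T U" "\<one> \<in> U"
  obtains V where "openin T V" "\<one> \<in> V" "\<And>a b. a \<in> V \<Longrightarrow> b \<in> V \<Longrightarrow> a \<otimes> b \<in> U"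
proof -
  let ?W = "{z \<in> topspace (prod_topology T T). (\<lambda>(x, y). x \<otimes> y) z \<in> U}"
  have "continuous_map (prod_topology T T) T (\<lambda>(x, y). x \<otimes> y)"
    using topological_group by (simp add: topological_group_def)
  then have W: "openin (prod_topology T T) ?W"
    using assms(1) by (rule openin_continuous_map_preimage)
  have "{\<one>} \<times> {\<one>} \<subseteq> ?W"
    using assms by auto
  moreover have "compactin T {\<one>}" by simp
  ultimately obtain A B where "openin T A" "openin T B" "{\<one>} \<subseteq> A" "{\<one>} \<subseteq> B" "A \<times> B \<subseteq> ?W"
    using Wallace_theorem_prod_topology[OF _ _ W] by blast
  then show thesis
    by (intro that[of "A \<inter> B"]) auto
qed

lemma symmetric_nbhd:
  assumes "openin T U" "\<one> \<in> U"
  obtains V where "openin T V" "\<one> \<in> V" "V \<subseteq> U" "\<And>a. a \<in> V \<Longrightarrow> inv a \<in> V"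
proof (rule that[of "U \<inter> {x \<in> carrier G. inv x \<in> U}"])
  show "openin T (U \<inter> {x \<in> carrier G. inv x \<in> U})"
    using openin_continuous_map_preimage[OF continuous_map_m_inv[OF continuous_map_idI] assms(1)] assms(1)
    by (auto intro!: openin_Int)
qed (use assms openin_subset_carrier in auto)

text \<open>The successor step of the chain construction: \<open>R\<close> bounds the new member,
  and \<open>C\<close> is the compact set by which it is conjugated.\<close>

lemma next_nbhd:
  assumes "openin T U" "\<one> \<in> U" "openin T R" "\<one> \<in> R" "compactin T C"
  obtains V where "openin T V" "\<one> \<in> V" "V \<subseteq> R" "\<And>a. a \<in> V \<Longrightarrow> inv a \<in> V"
    "\<And>a b. a \<in> V \<Longrightarrow> b \<in> V \<Longrightarrow> a \<otimes> b \<in> U" "\<And>v x. v \<in> V \<Longrightarrow> x \<in> C \<Longrightarrow> inv x \<otimes> v \<otimes> x \<in> U"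
proof -
  obtain A where A: "openin T A" "\<one> \<in> A" "\<And>a b. a \<in> A \<Longrightarrow> b \<in> A \<Longrightarrow> a \<otimes> b \<in> U"
    using square_nbhd[OF assms(1,2)] by blast
  obtain B where B: "openin T B" "\<one> \<in> B" "\<And>v x. v \<in> B \<Longrightarrow> x \<in> C \<Longrightarrow> inv x \<otimes> v \<otimes> x \<in> U"
    using conj_tube[OF assms(5,1,2)] by blast
  have "openin T (A \<inter> B \<inter> R)" "\<one> \<in> A \<inter> B \<inter> R"
    using A B assms by auto
  from symmetric_nbhd[OF this] obtain V where "openin T V" "\<one> \<in> V" "V \<subseteq> A \<inter> B \<inter> R"
    "\<And>a. a \<in> V \<Longrightarrow> inv a \<in> V" by blast
  then show thesis
    using A(3) B(3) by (intro that[of V]) (simp_all add: subset_iff)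
qed

section \<open>Neighbourhood chains and their intersections\<close>

definition nbhd_chain :: "(nat \<Rightarrow> 'a set) \<Rightarrow> bool" where
  "nbhd_chain V \<longleftrightarrow> (\<forall>n. openin T (V n) \<and> \<one> \<in> V n \<and> (\<forall>a\<in>V n. inv a \<in> V n) \<and>
     (\<forall>a\<in>V (Suc n). \<forall>b\<in>V (Suc n). a \<otimes> b \<in> V n))"

text \<open>This is the construction behind the Kakutani-Kodaira theorem: the intersection of such a
  chain is a compact normal subgroup with metrizable quotient. The index \<open>m\<close> may depend
  on \<open>x\<close>, since conjugation is controlled uniformly only over compact sets.\<close>

definition normal_chain :: "(nat \<Rightarrow> 'a set) \<Rightarrow> bool" where
  "normal_chain V \<longleftrightarrow> nbhd_chain V \<and> (\<exists>\<Omega>. compactin T \<Omega> \<and> V 0 \<subseteq> \<Omega>) \<and>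
     (\<forall>x\<in>carrier G. \<forall>n. \<exists>m. \<forall>v\<in>V m. inv x \<otimes> v \<otimes> x \<in> V n)"

lemma nbhd_chain_exists:
  assumes Y: "\<And>n. compactin T (Y n)" and R: "\<And>n. openin T (R n)" "\<And>n. \<one> \<in> R n"
  obtains V where "nbhd_chain V" "\<And>n. V n \<subseteq> R n"
    "\<And>m n x v. m \<le> n \<Longrightarrow> x \<in> Y m \<Longrightarrow> v \<in> V (Suc n) \<Longrightarrow> inv x \<otimes> v \<otimes> x \<in> V n"
proof -
  define P where "P n U \<longleftrightarrow> openin T U \<and> \<one> \<in> U \<and> U \<subseteq> R n \<and> (\<forall>a\<in>U. inv a \<in> U)" for n U
  \<comment> \<open>Conjugation into \<open>U\<close> is asked only for elements of
    \<open>Y 0\<close> up to \<open>Y n\<close>, which form a compact set; each element of the union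
    of all \<open>Y m\<close> is then controlled from some index on.\<close>
  define Q where "Q n U V \<longleftrightarrow> (\<forall>a\<in>V. \<forall>b\<in>V. a \<otimes> b \<in> U) \<and>
    (\<forall>x\<in>(\<Union>m\<le>n. Y m). \<forall>v\<in>V. inv x \<otimes> v \<otimes> x \<in> U)" for n :: nat and U V
  have "\<exists>U. P 0 U"
    unfolding P_def by (rule symmetric_nbhd[OF R, of 0]) blast
  moreover have "\<exists>V. P (Suc n) V \<and> Q n U V" if "P n U" for n U
  proof -
    have "compactin T (\<Union>m\<le>n. Y m)"
      using Y by (intro compactin_Union) auto
    from next_nbhd[OF _ _ R[of "Suc n"] this] that show ?thesis
      unfolding P_def Q_def by (metis (no_types, lifting))
  qed
  ultimately obtain V where V: "\<And>n. P n (V n)" "\<And>n. Q n (V n) (V (Suc n))"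
    using dependent_nat_choice[of P Q] by blast
  show thesis
  proof (rule that[of V])
    show "nbhd_chain V"
      using V unfolding nbhd_chain_def P_def Q_def by blast
    show "V n \<subseteq> R n" for n
      using V(1) by (auto simp: P_def)
    show "inv x \<otimes> v \<otimes> x \<in> V n" if "m \<le> n" "x \<in> Y m" "v \<in> V (Suc n)" for m n x v
      using V(2)[of n] that by (auto simp: Q_def)
  qed
qed

lemma nbhd_chainD:
  assumes "nbhd_chain V"
  shows "openin T (V n)" "\<one> \<in> V n" "a \<in> V n \<Longrightarrow> inv a \<in> V n"
    "a \<in> V (Suc n) \<Longrightarrow> b \<in> V (Suc n) \<Longrightarrow> a \<otimes> b \<in> V n" "V n \<subseteq> carrier G"
  using assms openin_subset_carrier unfolding nbhd_chain_def by auto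

lemma nbhd_chain_antimono:
  assumes "nbhd_chain V" "m \<le> n"
  shows "V n \<subseteq> V m"
proof -
  have "V (Suc n) \<subseteq> V n" for n
  proof
    fix a assume a: "a \<in> V (Suc n)"
    with nbhd_chainD(4)[OF assms(1) this nbhd_chainD(2)[OF assms(1)]] nbhd_chainD(5)[OF assms(1)]
    show "a \<in> V n" by force
  qed
  then show ?thesis
    using assms(2) by (rule lift_Suc_antimono_le)
qed

lemma normal_chain_exists:
  fixes Y :: "nat \<Rightarrow> 'a set"
  assumes lc: "locally_compact_space T"
    and Y: "\<And>n. compactin T (Y n)" "(\<Union>n. Y n) = carrier G"
    and R: "\<And>n. openin T (R n)" "\<And>n. \<one> \<in> R n"
  obtains V where "normal_chain V" "\<And>n. V n \<subseteq> R n"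
proof -
  obtain U \<Omega> where U: "openin T U" "compactin T \<Omega>" "\<one> \<in> U" "U \<subseteq> \<Omega>"
    using lc[unfolded locally_compact_space_def, rule_format, of \<one>] by auto
  obtain V where V: "nbhd_chain V" "\<And>n. V n \<subseteq> R n \<inter> U"
    "\<And>m n x v. m \<le> n \<Longrightarrow> x \<in> Y m \<Longrightarrow> v \<in> V (Suc n) \<Longrightarrow> inv x \<otimes> v \<otimes> x \<in> V n"
  proof (rule nbhd_chain_exists[of Y "\<lambda>n. R n \<inter> U"])
    show "openin T (R n \<inter> U)" "\<one> \<in> R n \<inter> U" for n
      using R U by auto
  qed (use Y(1) in simp_all)
  have "\<exists>k. \<forall>v\<in>V k. inv x \<otimes> v \<otimes> x \<in> V n" if "x \<in> carrier G" for x n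
  proof -
    have "x \<in> (\<Union>n. Y n)" using that Y(2) by simp
    then obtain m where m: "x \<in> Y m" by blast
    have "V (max m n) \<subseteq> V n"
      using V(1) by (rule nbhd_chain_antimono) simp
    then show ?thesis
      using V(3)[OF _ m, of "max m n"] by (intro exI[of _ "Suc (max m n)"]) auto
  qed
  moreover have "V 0 \<subseteq> \<Omega>"
    using V(2)[of 0] U by auto
  ultimately have "normal_chain V"
    using V(1) U(2) by (auto simp: normal_chain_def)
  with V(2) show thesis
    using that by blast
qed

context
  fixes V :: "nat \<Rightarrow> 'a set" and K :: "'a set"
  assumes V: "normal_chain V" and K_def: "K = (\<Inter>n. V n)"
begin

lemmas chain = nbhd_chainD[OF conjunct1[OF V[unfolded normal_chain_def]]]
lemmas chain_antimono = nbhd_chain_antimono[OF conjunct1[OF V[unfolded normal_chain_def]]]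

lemma subgroup_Inter_chain: "subgroup K G"
proof
  show "K \<subseteq> carrier G" using chain(5) by (auto simp: K_def)
qed (use chain in \<open>auto simp: K_def\<close>)

lemma conj_Inter_chain:
  assumes "x \<in> carrier G" "k \<in> K"
  shows "inv x \<otimes> k \<otimes> x \<in> K"
  using V assms unfolding K_def normal_chain_def by (metis INT_iff UNIV_I)

text \<open>A closure point \<open>y\<close> satisfies \<open>y \<otimes> v = w\<close> with
  \<open>v\<close> and \<open>w\<close> in \<open>V (Suc n)\<close>, and the chain condition absorbs
  \<open>w \<otimes> inv v\<close>. So \<open>K\<close> is also the intersection of the
  closures.\<close>

lemma closure_chain: "T closure_of V (Suc n) \<subseteq> V n"
proof
  fix y assume y: "y \<in> T closure_of V (Suc n)"
  then have yG: "y \<in> carrier G"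
    using closure_of_subset_topspace by fastforce
  let ?U = "(\<lambda>x. y \<otimes> x) ` V (Suc n)"
  have "openin T ?U" "y \<in> ?U"
    using yG chain(1,2) by (auto intro!: openin_mult_image image_eqI[of _ _ \<one>])
  with y obtain v w where vw: "v \<in> V (Suc n)" "w \<in> V (Suc n)" "w = y \<otimes> v"
    unfolding in_closure_of by blast
  then have "y = w \<otimes> inv v"
    using yG chain(5)[of "Suc n"] by (simp add: inv_solve_right subset_iff)
  then show "y \<in> V n"
    using chain(3,4) vw by metis
qed

text \<open>Inside the compact \<open>\<Omega>\<close> the closures of the \<open>V n\<close>
  decrease to \<open>K\<close>, so an open set that contains \<open>K\<close> already contains some
  \<open>V n\<close>; this is applied to the preimage of \<open>O'\<close> under translation by
  \<open>x\<close>.\<close>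

lemma saturated_nbhd:
  assumes x: "x \<in> carrier G" and O': "openin T O'" and sat: "\<And>k. k \<in> K \<Longrightarrow> x \<otimes> k \<in> O'"
  obtains n where "\<And>v. v \<in> V n \<Longrightarrow> x \<otimes> v \<in> O'"
proof -
  obtain \<Omega> where \<Omega>: "compactin T \<Omega>" "V 0 \<subseteq> \<Omega>"
    using V by (auto simp: normal_chain_def)
  define P where "P = {y \<in> carrier G. x \<otimes> y \<in> O'}"
  define C where "C n = carrier G - T closure_of V n" for n
  have "\<Omega> \<subseteq> \<Union>(insert P (range C))"
  proof
    fix y assume "y \<in> \<Omega>"
    then have y: "y \<in> carrier G"
      using compactin_subset_carrier[OF \<Omega>(1)] by auto
    show "y \<in> \<Union>(insert P (range C))"
    proof (cases "y \<in> K")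
      case False
      then obtain n where "y \<notin> V n" by (auto simp: K_def)
      then have "y \<in> C (Suc n)" using closure_chain y by (auto simp: C_def)
      then show ?thesis by auto
    qed (use y sat in \<open>auto simp: P_def\<close>)
  qed
  moreover have "openin T U" if "U \<in> insert P (range C)" for U
    using that openin_mult_preimage[OF x O'] openin_diff[OF openin_topspace[of T] closedin_closure_of]
    by (auto simp: P_def C_def)
  ultimately obtain \<F> where \<F>: "finite \<F>" "\<F> \<subseteq> insert P (range C)" "\<Omega> \<subseteq> \<Union>\<F>"
    using compactinD[OF \<Omega>(1), of "insert P (range C)"] by auto
  then have "finite (\<F> - {P})" "\<F> - {P} \<subseteq> range C" by auto
  then obtain I where I: "finite I" "\<F> - {P} = C ` I"
    by (meson finite_subset_image)
  obtain n where n: "I \<subseteq> {..n}"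
    using I(1) finite_nat_iff_bounded_le by auto
  show thesis
  proof (rule that[of n])
    fix v assume v: "v \<in> V n"
    have "v \<notin> C i" if "i \<in> I" for i
    proof -
      have "v \<in> V i" using n that v chain_antimono[of i n] by auto
      then show ?thesis
        using closure_of_subset[of "V i" T] chain(5) by (auto simp: C_def)
    qed
    moreover have "v \<in> \<Omega>"
      using v chain_antimono[of 0 n] \<Omega>(2) by auto
    ultimately have "v \<in> P"
      using \<F>(3) I(2) by blast
    then show "x \<otimes> v \<in> O'" by (simp add: P_def)
  qed
qed

text \<open>The quotient by \<open>K\<close> is sigma-compact and metrizable, hence second
  countable. Without forming it, countably many translates of the \<open>V n\<close> serve as a base
  at cosets of \<open>K\<close>.\<close>

lemma countable_saturated_base:
  fixes Y :: "nat \<Rightarrow> 'a set"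
  assumes Y: "\<And>n. compactin T (Y n)" "(\<Union>n. Y n) = carrier G"
  obtains \<B> where "countable \<B>" "\<And>B. B \<in> \<B> \<Longrightarrow> openin T B"
    "\<And>x O'. x \<in> carrier G \<Longrightarrow> openin T O' \<Longrightarrow> (\<And>k. k \<in> K \<Longrightarrow> x \<otimes> k \<in> O')
      \<Longrightarrow> \<exists>B\<in>\<B>. x \<in> B \<and> B \<subseteq> O'"
proof -
  have "\<exists>D. finite D \<and> D \<subseteq> Y m \<and> Y m \<subseteq> (\<Union>y\<in>D. (\<lambda>v. y \<otimes> v) ` V n)" for m n
  proof -
    have "Y m \<subseteq> \<Union>((\<lambda>y. (\<lambda>v. y \<otimes> v) ` V n) ` Y m)"
      using chain(2)[of n] compactin_subset_carrier[OF Y(1)[of m]] by force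
    moreover have "openin T U" if "U \<in> (\<lambda>y. (\<lambda>v. y \<otimes> v) ` V n) ` Y m" for U
      using that compactin_subset_carrier[OF Y(1)[of m]] chain(1) by (auto intro: openin_mult_image)
    ultimately obtain \<F> where "finite \<F>" "\<F> \<subseteq> (\<lambda>y. (\<lambda>v. y \<otimes> v) ` V n) ` Y m" "Y m \<subseteq> \<Union>\<F>"
      using compactinD[OF Y(1)[of m], of "(\<lambda>y. (\<lambda>v. y \<otimes> v) ` V n) ` Y m"] by auto
    then show ?thesis
      by (metis finite_subset_image)
  qed
  then obtain D where D: "\<And>m n. finite (D m n)" "\<And>m n. D m n \<subseteq> Y m"
    "\<And>m n. Y m \<subseteq> (\<Union>y\<in>D m n. (\<lambda>v. y \<otimes> v) ` V n)"
    by metis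
  have DG: "D m n \<subseteq> carrier G" for m n
    using D(2)[of m n] compactin_subset_carrier[OF Y(1)[of m]] by simp
  define \<B> where "\<B> = (\<Union>m. \<Union>n. (\<lambda>y. (\<lambda>v. y \<otimes> v) ` V n) ` D m n)"
  show thesis
  proof (rule that[of \<B>])
    show "countable \<B>"
      unfolding \<B>_def using D(1) by (intro countable_UN countable_image countable_finite countableI_type)
    show "openin T B" if "B \<in> \<B>" for B
      using that subsetD[OF DG] chain(1)
      by (auto simp: \<B>_def intro!: openin_mult_image)
    fix x O' assume x: "x \<in> carrier G" and O': "openin T O'" and k: "\<And>k. k \<in> K \<Longrightarrow> x \<otimes> k \<in> O'"
    obtain n where n: "\<And>v. v \<in> V n \<Longrightarrow> x \<otimes> v \<in> O'"
      using saturated_nbhd[OF x O' k] by blast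
    have "x \<in> (\<Union>n. Y n)" using x Y(2) by simp
    then obtain m where "x \<in> Y m" by blast
    \<comment> \<open>The index \<open>Suc n\<close> leaves room for recentring: for
      \<open>x = y \<otimes> v\<close> the translate of \<open>V (Suc n)\<close> by \<open>y\<close>
      lies in the translate of \<open>V n\<close> by \<open>x\<close>.\<close>
    then obtain y v where yv: "y \<in> D m (Suc n)" "v \<in> V (Suc n)" "x = y \<otimes> v"
      using D(3)[of m "Suc n"] by auto
    have y: "y \<in> carrier G"
      using yv(1) DG by blast
    have v: "v \<in> carrier G"
      using yv(2) chain(5) by blast
    let ?B = "(\<lambda>v. y \<otimes> v) ` V (Suc n)"
    have "?B \<subseteq> O'"
    proof clarify
      fix w assume w: "w \<in> V (Suc n)"
      have wG: "w \<in> carrier G" using w chain(5) by blast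
      have "x \<otimes> (inv v \<otimes> w) = y \<otimes> w"
        using y v wG by (simp add: yv(3) m_assoc) (simp flip: m_assoc)
      moreover have "inv v \<otimes> w \<in> V n"
        using chain(3,4) yv(2) w by blast
      ultimately show "y \<otimes> w \<in> O'"
        using n by metis
    qed
    moreover have "x \<in> ?B" "?B \<in> \<B>"
      using yv by (auto simp: \<B>_def)
    ultimately show "\<exists>B\<in>\<B>. x \<in> B \<and> B \<subseteq> O'" by (intro bexI[of _ ?B] conjI)
  qed
qed

end

end

section \<open>Left Haar measures on sigma-compact groups\<close>

lemma closedin_borel_sets_of: "closedin T C \<Longrightarrow> C \<in> borel_sets_of T"
proof -
  assume C: "closedin T C"
  then have "topspace T - (topspace T - C) \<in> borel_sets_of T"
    unfolding borel_sets_of_def by (intro sigma_sets.Compl sigma_sets.Basic) auto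
  moreover have "topspace T - (topspace T - C) = C"
    using closedin_subset[OF C] by auto
  ultimately show ?thesis by simp
qed

lemma ennreal_eq_0_if_le_inverse_Suc:
  fixes a :: ennreal
  assumes "\<And>j::nat. a \<le> ennreal (1 / real (Suc j))"
  shows "a = 0"
proof (rule ccontr)
  assume "a \<noteq> 0"
  moreover have "a < \<infinity>"
    using assms[of 0] by (simp add: order_le_less_trans)
  ultimately obtain r where r: "a = ennreal r" "0 < r"
    by (cases a) auto
  obtain j where "1 / real (Suc j) < r"
    using r(2) nat_approx_posE by metis
  with assms[of j] r show False
    by (simp add: ennreal_le_iff)
qed

text \<open>Inner approximation comes from outer regularity here: a compact set of positive measure
  inside a given set is found as some \<open>Y n\<close> minus an open set around what has to be
  avoided.\<close>

locale left_haar = top_group G T for G :: "('a, 'm) monoid_scheme" (structure) and T +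
  fixes M :: "'a measure" and Y :: "nat \<Rightarrow> 'a set"
  assumes locally_compact: "locally_compact_space T"
    and compact_Y: "\<And>n. compactin T (Y n)" and Union_Y: "(\<Union>n. Y n) = carrier G"
    and space_M: "space M = carrier G" and sets_M: "sets M = borel_sets_of T"
    and compact_finite: "\<And>C. compactin T C \<Longrightarrow> emeasure M C < \<infinity>"
    and outer_regular: "\<And>A. A \<in> sets M \<Longrightarrow>
      emeasure M A = (INF U\<in>{U. openin T U \<and> A \<subseteq> U}. emeasure M U)"
    and left_invariant: "\<And>g A. g \<in> carrier G \<Longrightarrow> A \<in> sets M \<Longrightarrow>
      (\<lambda>x. g \<otimes> x) ` A \<in> sets M \<and> emeasure M ((\<lambda>x. g \<otimes> x) ` A) = emeasure M A"
begin

abbreviation N where "N \<equiv> completion M"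

lemma open_sets: "openin T U \<Longrightarrow> U \<in> sets M"
  by (auto simp: sets_M borel_sets_of_def)

section \<open>Translates and supports of compact sets\<close>

lemma compact_sets: "compactin T C \<Longrightarrow> C \<in> sets M"
  using compactin_imp_closedin[OF Hausdorff] closedin_borel_sets_of[of T C] by (simp add: sets_M)

lemma compactin_diff_open:
  assumes "compactin T C" "openin T U"
  shows "compactin T (C - U)"
proof -
  have "compactin T ((topspace T - U) \<inter> C)"
    by (intro closed_Int_compactin assms closedin_diff closedin_topspace)
  moreover have "(topspace T - U) \<inter> C = C - U"
    using compactin_subset_topspace[OF assms(1)] by auto
  ultimately show ?thesis by simp
qed

lemma outer_nbhd:
  assumes "A \<in> sets M" "emeasure M A < e"
  obtains U where "openin T U" "A \<subseteq> U" "emeasure M U < e"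
  using assms outer_regular[OF assms(1)] by (auto simp: INF_less_iff)

lemma null_translate:
  assumes "g \<in> carrier G" "A \<in> null_sets N"
  shows "(\<lambda>x. g \<otimes> x) ` A \<in> null_sets N"
proof -
  obtain B where "B \<in> null_sets M" "A \<subseteq> B"
    using assms(2) unfolding null_sets_completion_iff2 by auto
  moreover from this(1) have "(\<lambda>x. g \<otimes> x) ` B \<in> null_sets M"
    using left_invariant[OF assms(1), of B] by (auto simp: null_sets_def)
  ultimately show ?thesis
    unfolding null_sets_completion_iff2 by blast
qed

text \<open>An open \<open>U\<close> around \<open>C\<close> has excess below \<open>e\<close>, and
  by \<open>mult_tube\<close> it contains the translates of \<open>C\<close> by all \<open>g\<close>
  near 1; what such a translate has outside \<open>C\<close> lies in \<open>U - C\<close>.\<close>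

lemma near_invariant:
  assumes C: "compactin T C" and e: "0 < e"
  obtains V where "openin T V" "\<one> \<in> V"
    "\<And>g. g \<in> V \<Longrightarrow> emeasure M ((\<lambda>x. g \<otimes> x) ` C - C) < e"
proof -
  have fin: "emeasure M C < \<infinity>" using compact_finite[OF C] .
  then have "emeasure M C < emeasure M C + e"
    using e ennreal_add_left_cancel_less[of "emeasure M C" 0 e] by auto
  then obtain U where U: "openin T U" "C \<subseteq> U" "emeasure M U < emeasure M C + e"
    using outer_nbhd[OF compact_sets[OF C]] by blast
  obtain V where V: "openin T V" "\<one> \<in> V" "\<And>v x. v \<in> V \<Longrightarrow> x \<in> C \<Longrightarrow> v \<otimes> x \<in> U"
    using mult_tube[OF C U(1,2)] by blast
  have "emeasure M C + emeasure M (U - C) = emeasure M U"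
    using U(2) compact_sets[OF C] open_sets[OF U(1)] by (subst plus_emeasure) (auto simp: Un_absorb1)
  then have "emeasure M (U - C) < e"
    using U(3) by (metis ennreal_add_left_cancel_less)
  moreover have "emeasure M ((\<lambda>x. g \<otimes> x) ` C - C) \<le> emeasure M (U - C)" if "g \<in> V" for g
    using V(3)[OF that] open_sets[OF U(1)] compact_sets[OF C] by (intro emeasure_mono) auto
  ultimately show thesis
    using V(1,2) that by (meson order_le_less_trans)
qed

text \<open>\<open>S\<close> is \<open>C\<close> without all open sets that meet it in a null set.
  There may be uncountably many of these; but for every open \<open>U\<close> around
  \<open>S\<close> the compact \<open>C - U\<close> is covered by finitely many, and outer
  regularity brings \<open>U\<close> close to \<open>S\<close> in measure.\<close>

lemma compact_support:
  assumes C: "compactin T C"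
  obtains S where "compactin T S" "S \<subseteq> C" "C - S \<in> null_sets M"
    "\<And>U. openin T U \<Longrightarrow> U \<inter> S \<noteq> {} \<Longrightarrow> emeasure M (U \<inter> S) \<noteq> 0"
proof -
  define \<U> where "\<U> = {U. openin T U \<and> emeasure M (U \<inter> C) = 0}"
  define W where "W = \<Union>\<U>"
  define S where "S = C - W"
  have W: "openin T W"
    unfolding W_def by (rule openin_Union) (simp add: \<U>_def)
  have S: "compactin T S"
    unfolding S_def by (rule compactin_diff_open[OF C W])
  have "emeasure M C \<le> emeasure M S"
  proof (rule ennreal_le_epsilon)
    fix e :: real assume "0 < e"
    then have "emeasure M S + 0 < emeasure M S + e"
      using compact_finite[OF S] by (subst ennreal_add_left_cancel_less) auto
    then have "emeasure M S < emeasure M S + e" by simp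
    then obtain U where U: "openin T U" "S \<subseteq> U" "emeasure M U < emeasure M S + e"
      using outer_nbhd[OF compact_sets[OF S]] by blast
    have D: "compactin T (C - U)"
      by (rule compactin_diff_open[OF C U(1)])
    have "C - U \<subseteq> \<Union>\<U>"
      using U(2) by (auto simp: S_def W_def)
    then obtain \<F> where \<F>: "finite \<F>" "\<F> \<subseteq> \<U>" "C - U \<subseteq> \<Union>\<F>"
      using compactinD[OF D, of \<U>] by (auto simp: \<U>_def)
    have null: "(\<Union>V\<in>\<F>. V \<inter> C) \<in> null_sets M"
      using \<F>(1,2) open_sets compact_sets[OF C]
      by (intro null_sets.finite_UN) (auto simp: \<U>_def null_sets_def)
    have "C - U \<subseteq> (\<Union>V\<in>\<F>. V \<inter> C)"
      using \<F>(3) by auto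
    then have "emeasure M (C - U) = 0"
      by (rule emeasure_eq_0[OF null_setsD2[OF null] null_setsD1[OF null]])
    have "emeasure M C \<le> emeasure M (U \<union> (C - U))"
      using open_sets[OF U(1)] compact_sets[OF C] by (intro emeasure_mono) auto
    also have "\<dots> \<le> emeasure M U + emeasure M (C - U)"
      using open_sets[OF U(1)] compact_sets[OF C] by (intro emeasure_subadditive) auto
    also have "\<dots> \<le> emeasure M S + e"
      using U(3) \<open>emeasure M (C - U) = 0\<close> by simp
    finally show "emeasure M C \<le> emeasure M S + e" .
  qed
  moreover have "emeasure M S + emeasure M (C - S) = emeasure M C"
    using compact_sets[OF C] compact_sets[OF S]
    by (subst plus_emeasure) (auto simp: S_def Un_absorb1)
  ultimately have "emeasure M S + emeasure M (C - S) \<le> emeasure M S + 0"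
    by simp
  then have "emeasure M (C - S) = 0"
    using compact_finite[OF S] by (auto simp: ennreal_add_left_cancel_le)
  then have null: "C - S \<in> null_sets M"
    using compact_sets[OF C] compact_sets[OF S] by (auto simp: null_sets_def)
  show thesis
  proof (rule that[OF S _ null])
    fix U assume U: "openin T U" "U \<inter> S \<noteq> {}"
    show "emeasure M (U \<inter> S) \<noteq> 0"
    proof
      assume "emeasure M (U \<inter> S) = 0"
      then have "(U \<inter> S) \<union> (C - S) \<in> null_sets M"
        using null open_sets[OF U(1)] compact_sets[OF S] by (intro null_sets.Un) (auto simp: null_sets_def)
      moreover have "U \<inter> C \<subseteq> (U \<inter> S) \<union> (C - S)" by auto
      ultimately have "emeasure M (U \<inter> C) = 0"
        by (metis emeasure_eq_0 null_setsD1 null_setsD2)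
      then have "U \<subseteq> W"
        using U(1) by (auto simp: W_def \<U>_def)
      then show False
        using U(2) by (auto simp: S_def)
    qed
  qed (simp add: S_def)
qed

text \<open>The points of \<open>S\<close> that \<open>g\<close> moves out of \<open>S\<close> form
  a relatively open set. If it is nonempty, it has positive measure, and so has its translate, which
  lies in the part of \<open>g S\<close> outside \<open>S\<close>.\<close>

lemma support_invariant:
  assumes S: "compactin T S" "\<And>U. openin T U \<Longrightarrow> U \<inter> S \<noteq> {} \<Longrightarrow> emeasure M (U \<inter> S) \<noteq> 0"
    and g: "g \<in> carrier G" "emeasure M ((\<lambda>x. g \<otimes> x) ` S - S) = 0"
  shows "(\<lambda>x. g \<otimes> x) ` S \<subseteq> S"
proof (rule ccontr)
  assume "\<not> ?thesis"
  then obtain x where x: "x \<in> S" "g \<otimes> x \<notin> S" by blast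
  have SG: "S \<subseteq> carrier G" using compactin_subset_carrier[OF S(1)] .
  define U where "U = {y \<in> carrier G. g \<otimes> y \<in> carrier G - S}"
  have "closedin T S"
    using compactin_imp_closedin[OF Hausdorff S(1)] .
  then have "openin T U"
    unfolding U_def using g(1) by (intro openin_mult_preimage) (auto simp: openin_diff closedin_def)
  moreover have "x \<in> U \<inter> S"
    using x g(1) SG by (auto simp: U_def)
  ultimately have "emeasure M (U \<inter> S) \<noteq> 0" "U \<inter> S \<in> sets M"
    using S(2) open_sets compact_sets[OF S(1)] by auto
  then have "emeasure M ((\<lambda>x. g \<otimes> x) ` (U \<inter> S)) \<noteq> 0"
    using left_invariant[OF g(1)] by simp
  moreover have "emeasure M ((\<lambda>x. g \<otimes> x) ` (U \<inter> S)) \<le> emeasure M ((\<lambda>x. g \<otimes> x) ` S - S)"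
    using left_invariant[OF g(1)] compact_sets[OF S(1)]
    by (intro emeasure_mono) (auto simp: U_def)
  ultimately show False
    using g(2) by simp
qed

text \<open>This replaces completion regularity of Haar measure: the complement of \<open>A\<close> contains, up to a
  null set, countably many compact sets that equal their support, and \<open>K = \<Inter>n. V n\<close> is chosen to
  preserve each of them.\<close>

lemma null_saturation:
  assumes "A \<in> null_sets N"
  obtains V where "normal_chain V" "A <#> (\<Inter>n. V n) \<in> null_sets N"
proof -
  obtain B where B: "B \<in> null_sets M" "A \<subseteq> B"
    using assms unfolding null_sets_completion_iff2 by auto
  have pos: "0 < ennreal (1 / real (Suc n))" for n
    by simp
  have "\<exists>U. openin T U \<and> B \<subseteq> U \<and> emeasure M U < ennreal (1 / real (Suc n))" for n
    using B(1) pos[of n] outer_nbhd[of B "ennreal (1 / real (Suc n))"] by (metis null_setsD1 null_setsD2)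
  then obtain U where U: "\<And>n. openin T (U n)" "\<And>n. B \<subseteq> U n" "\<And>n. emeasure M (U n) < ennreal (1 / real (Suc n))"
    by metis
  \<comment> \<open>Each \<open>Y m - U n\<close> avoids \<open>A\<close>, because
    \<open>U n\<close> contains \<open>B\<close>. Passing to supports costs a null set and allows
    exact invariance later.\<close>
  have "\<exists>S. compactin T S \<and> S \<subseteq> Y m - U n \<and> (Y m - U n) - S \<in> null_sets M \<and>
      (\<forall>U. openin T U \<longrightarrow> U \<inter> S \<noteq> {} \<longrightarrow> emeasure M (U \<inter> S) \<noteq> 0)" for m n
    using compact_support[OF compactin_diff_open[OF compact_Y U(1)], of m n] by (metis (no_types, lifting))
  then obtain S where S: "\<And>m n. compactin T (S m n)" "\<And>m n. S m n \<subseteq> Y m - U n"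
    "\<And>m n. (Y m - U n) - S m n \<in> null_sets M"
    "\<And>m n. \<forall>O'. openin T O' \<longrightarrow> O' \<inter> S m n \<noteq> {} \<longrightarrow> emeasure M (O' \<inter> S m n) \<noteq> 0"
    by metis
  have "\<exists>R. openin T R \<and> \<one> \<in> R \<and> (\<forall>g\<in>R. emeasure M ((\<lambda>x. g \<otimes> x) ` S m n - S m n) < ennreal (1 / real (Suc j)))" for m n j
    using near_invariant[OF S(1)[of m n] pos[of j]] by metis
  then obtain R where R: "\<And>m n j. openin T (R m n j)" "\<And>m n j. \<one> \<in> R m n j"
    "\<And>m n j g. g \<in> R m n j \<Longrightarrow> emeasure M ((\<lambda>x. g \<otimes> x) ` S m n - S m n) < ennreal (1 / real (Suc j))"
    by metis
  \<comment> \<open>One sequence has to serve all triples: \<open>V (to_nat (m, n, j))\<close> lies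
    in \<open>R m n j\<close>, so an element of \<open>K\<close> obeys the bound for every
    \<open>j\<close>.\<close>
  define R' where "R' i = (case from_nat i of (m, n, j) \<Rightarrow> R m n j)" for i :: nat
  obtain V where V: "normal_chain V" "\<And>i. V i \<subseteq> R' i"
  proof (rule normal_chain_exists[OF locally_compact compact_Y Union_Y, of R'])
    show "openin T (R' i)" "\<one> \<in> R' i" for i
      using R(1,2) by (auto simp: R'_def split: prod.split)
  qed blast
  define K where "K = (\<Inter>n. V n)"
  interpret K: subgroup K G
    by (rule subgroup_Inter_chain[OF V(1) K_def])
  have inv: "k \<otimes> x \<in> S m n" if "k \<in> K" "x \<in> S m n" for k x m n
  proof -
    have "emeasure M ((\<lambda>x. k \<otimes> x) ` S m n - S m n) = 0"
    proof (rule ennreal_eq_0_if_le_inverse_Suc)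
      fix j :: nat
      have "k \<in> V (to_nat (m, n, j))"
        using that(1) by (simp add: K_def)
      then have "k \<in> R m n j"
        using V(2)[of "to_nat (m, n, j)"] by (auto simp: R'_def)
      then show "emeasure M ((\<lambda>x. k \<otimes> x) ` S m n - S m n) \<le> ennreal (1 / real (Suc j))"
        using R(3) by (auto intro: less_imp_le)
    qed
    then have "(\<lambda>x. k \<otimes> x) ` S m n \<subseteq> S m n"
      using S(1,4) that(1) K.subset by (intro support_invariant) auto
    then show ?thesis using that(2) by blast
  qed
  define Z where "Z = carrier G - (\<Union>m. \<Union>n. S m n)"
  have SG: "S m n \<subseteq> carrier G" for m n
    using compactin_subset_carrier[OF S(1)] .
  have "(\<Inter>n. U n) \<in> null_sets M"
  proof -
    have "(\<Inter>n. U n) \<in> sets M"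
      using U(1) open_sets by (intro sets.countable_INT) auto
    moreover have "emeasure M (\<Inter>n. U n) = 0"
    proof (rule ennreal_eq_0_if_le_inverse_Suc)
      fix j :: nat
      have "emeasure M (\<Inter>n. U n) \<le> emeasure M (U j)"
        using U(1) open_sets by (intro emeasure_mono) auto
      then show "emeasure M (\<Inter>n. U n) \<le> ennreal (1 / real (Suc j))"
        using U(3)[of j] by simp
    qed
    ultimately show ?thesis by (simp add: null_sets_def)
  qed
  then have "(\<Inter>n. U n) \<union> (\<Union>m. \<Union>n. (Y m - U n) - S m n) \<in> null_sets M"
    using S(3) by (intro null_sets.Un null_sets_UN) auto
  moreover have "Z \<subseteq> (\<Inter>n. U n) \<union> (\<Union>m. \<Union>n. (Y m - U n) - S m n)"
  proof
    fix x assume x: "x \<in> Z"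
    then have "x \<in> (\<Union>n. Y n)"
      by (simp add: Z_def Union_Y)
    then obtain m where "x \<in> Y m" by blast
    with x show "x \<in> (\<Inter>n. U n) \<union> (\<Union>m. \<Union>n. (Y m - U n) - S m n)"
      by (auto simp: Z_def)
  qed
  ultimately have Z: "Z \<in> null_sets N"
    unfolding null_sets_completion_iff2 by blast
  have AG: "A \<subseteq> carrier G"
    using B sets.sets_into_space[of B M] by (auto simp: space_M)
  \<comment> \<open>\<open>a\<close> is \<open>a \<otimes> inv k \<otimes> inv a\<close> times
    \<open>a \<otimes> k\<close>, and the first factor is in \<open>K\<close> by normality. If
    \<open>a \<otimes> k\<close> were in \<open>S m n\<close>, left invariance would put
    \<open>a\<close> there, but \<open>A\<close> avoids every \<open>S m n\<close>.\<close>
  have "a \<otimes> k \<in> Z" if a: "a \<in> A" and k: "k \<in> K" for a k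
  proof (rule ccontr)
    have aG: "a \<in> carrier G" and kG: "k \<in> carrier G"
      using a k AG by auto
    assume "a \<otimes> k \<notin> Z"
    then obtain m n where mn: "a \<otimes> k \<in> S m n"
      using aG kG by (auto simp: Z_def)
    have "a \<otimes> inv k \<otimes> inv a \<in> K"
      using conj_Inter_chain[OF V(1) K_def, of "inv a" "inv k"] k aG by simp
    from inv[OF this mn] have "a \<in> S m n"
      using aG kG by (simp add: m_assoc inv_solve_left' flip: m_assoc) (simp add: m_assoc)
    then show False
      using S(2) U(2) B(2) a by blast
  qed
  then have "A <#> K \<subseteq> Z"
    by (auto simp: set_mult_def)
  then show thesis
    using V(1) Z that null_sets_completion_subset by (metis K_def)
qed

text \<open>It is enough to find a compact \<open>C\<close> inside \<open>A\<close> with positive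
  measure: for \<open>v\<close> near 1 the part of \<open>v C\<close> outside \<open>C\<close> has
  smaller measure than \<open>v C\<close>, so \<open>v C\<close> meets \<open>C\<close>.\<close>

lemma Steinhaus:
  assumes "A \<in> sets N" "A \<notin> null_sets N"
  obtains V where "openin T V" "\<one> \<in> V" "\<And>v. v \<in> V \<Longrightarrow> \<exists>a\<in>A. \<exists>b\<in>A. v = a \<otimes> inv b"
proof -
  define B where "B = main_part M A"
  have B: "B \<in> sets M" "B \<subseteq> A" "emeasure M B \<noteq> 0"
  proof -
    show "B \<in> sets M"
      using assms(1) by (simp add: B_def)
    show "B \<subseteq> A"
      using main_part_null_part_Un[OF assms(1)] by (metis B_def Un_upper1)
    show "emeasure M B \<noteq> 0"
      using assms by (auto simp: B_def null_sets_def)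
  qed
  have "\<exists>n. emeasure M (B \<inter> Y n) \<noteq> 0"
  proof (rule ccontr)
    assume "\<not> ?thesis"
    then have "(\<Union>n. B \<inter> Y n) \<in> null_sets M"
      using B(1) compact_sets[OF compact_Y] by (intro null_sets_UN) (auto simp: null_sets_def)
    moreover have "(\<Union>n. B \<inter> Y n) = B"
      using sets.sets_into_space[OF B(1)] Union_Y by (auto simp: space_M)
    ultimately show False
      using B(3) by auto
  qed
  then obtain n where n: "emeasure M (B \<inter> Y n) \<noteq> 0" by blast
  have Yn: "Y n \<in> sets M" "emeasure M (Y n) < \<infinity>"
    using compact_sets[OF compact_Y] compact_finite[OF compact_Y] by auto
  have sum: "emeasure M (Y n - B) + emeasure M (B \<inter> Y n) = emeasure M (Y n)"
    using B(1) Yn(1) by (subst plus_emeasure) (auto intro: arg_cong[of _ _ "emeasure M"])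
  then have "emeasure M (Y n - B) < \<infinity>"
    using Yn(2) by (metis add_top ennreal_add_eq_top infinity_ennreal_def less_top)
  then have "emeasure M (Y n - B) + 0 < emeasure M (Y n - B) + emeasure M (B \<inter> Y n)"
    using n by (subst ennreal_add_left_cancel_less) (auto simp: zero_less_iff_neq_zero)
  then have "emeasure M (Y n - B) < emeasure M (Y n)"
    by (simp add: sum)
  \<comment> \<open>\<open>U\<close> contains all of \<open>Y n\<close> outside \<open>B\<close> but
    is too small to cover \<open>Y n\<close> up to a null set; hence \<open>Y n - U\<close> is a
    subset of \<open>B\<close> of positive measure.\<close>
  then obtain U where U: "openin T U" "Y n - B \<subseteq> U" "emeasure M U < emeasure M (Y n)"
    using outer_nbhd[of "Y n - B"] B(1) Yn(1) by blast
  define C where "C = Y n - U"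
  have C: "compactin T C"
    unfolding C_def by (rule compactin_diff_open[OF compact_Y U(1)])
  have "emeasure M (Y n) \<le> emeasure M (U \<union> C)"
    using open_sets[OF U(1)] compact_sets[OF C] by (intro emeasure_mono sets.Un) (auto simp: C_def)
  also have "\<dots> \<le> emeasure M U + emeasure M C"
    using open_sets[OF U(1)] compact_sets[OF C] by (intro emeasure_subadditive) auto
  finally have "0 < emeasure M C"
    using U(3) by (auto simp: zero_less_iff_neq_zero)
  from near_invariant[OF C this] obtain V where V: "openin T V" "\<one> \<in> V"
    "\<And>g. g \<in> V \<Longrightarrow> emeasure M ((\<lambda>x. g \<otimes> x) ` C - C) < emeasure M C" by blast
  show thesis
  proof (rule that[OF V(1,2)])
    fix v assume v: "v \<in> V"
    then have vG: "v \<in> carrier G"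
      using openin_subset_carrier[OF V(1)] by blast
    have "(\<lambda>x. v \<otimes> x) ` C \<inter> C \<noteq> {}"
    proof
      assume "(\<lambda>x. v \<otimes> x) ` C \<inter> C = {}"
      then have "(\<lambda>x. v \<otimes> x) ` C - C = (\<lambda>x. v \<otimes> x) ` C" by auto
      then show False
        using V(3)[OF v] left_invariant[OF vG compact_sets[OF C]] by simp
    qed
    then obtain b where b: "b \<in> C" "v \<otimes> b \<in> C" by blast
    then have "b \<in> carrier G" using compactin_subset_carrier[OF C] by blast
    then have "v = (v \<otimes> b) \<otimes> inv b"
      using vG by (simp add: m_assoc)
    moreover have "C \<subseteq> A"
      using U(2) B(2) by (auto simp: C_def)
    ultimately show "\<exists>a\<in>A. \<exists>b\<in>A. v = a \<otimes> inv b"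
      using b by blast
  qed
qed

section \<open>From a null neighbourhood to a null group\<close>

lemma sigma_finite_completion: "sigma_finite_measure N"
proof
  show "\<exists>A. countable A \<and> A \<subseteq> sets N \<and> \<Union>A = space N \<and> (\<forall>a\<in>A. emeasure N a \<noteq> \<infinity>)"
    using compact_sets[OF compact_Y] compact_finite[OF compact_Y] Union_Y
    by (intro exI[of _ "range Y"]) (auto simp: space_M less_top)
qed

text \<open>The target group enters only through the measurability of \<open>Z <#> P n\<close> for
  arbitrary \<open>Z\<close>. The translates of the \<open>P n\<close> are neighbourhoods for a
  pseudometrizable topology, which is what Stone's construction exploits.\<close>

lemma nbhd_sequence_not_null:
  fixes P :: "nat \<Rightarrow> 'a set"
  assumes P: "\<And>n. P n \<subseteq> carrier G" "\<And>n. \<one> \<in> P n" "\<And>n p. p \<in> P n \<Longrightarrow> inv p \<in> P n"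
    "\<And>n p q. p \<in> P (Suc n) \<Longrightarrow> q \<in> P (Suc n) \<Longrightarrow> p \<otimes> q \<in> P n"
    and meas: "\<And>Z n. Z \<subseteq> carrier G \<Longrightarrow> Z <#> P n \<in> sets N"
    and nonnull: "emeasure M (carrier G) \<noteq> 0"
  shows "P 0 \<notin> null_sets N"
proof
  assume "P 0 \<in> null_sets N"
  then obtain V where V: "normal_chain V" and null0: "P 0 <#> (\<Inter>n. V n) \<in> null_sets N"
    by (rule null_saturation)
  define K where "K = (\<Inter>n. V n)"
  interpret K: subgroup K G
    by (rule subgroup_Inter_chain[OF V K_def])
  have conj: "inv x \<otimes> k \<otimes> x \<in> K" if "x \<in> carrier G" "k \<in> K" for x k
    by (rule conj_Inter_chain[OF V K_def that])
  have conj': "x \<otimes> k \<otimes> inv x \<in> K" if "x \<in> carrier G" "k \<in> K" for x k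
    using conj[of "inv x" k] that by simp
  have PG: "p \<in> carrier G" if "p \<in> P n" for p n
    using that P(1) by blast
  \<comment> \<open>Because \<open>K\<close> is normal, \<open>Q n\<close> inherits the group
    properties of \<open>P n\<close>, and its left translates are unions of cosets of
    \<open>K\<close>.\<close>
  define Q where "Q n = P n <#> K" for n
  have KP: "K <#> P n = Q n" for n
  proof (intro equalityI subsetI)
    fix y assume "y \<in> K <#> P n"
    then obtain k p where kp: "k \<in> K" "p \<in> P n" "y = k \<otimes> p"
      by (auto simp: set_mult_def)
    then have "y = p \<otimes> (inv p \<otimes> k \<otimes> p)"
      using PG by (simp flip: m_assoc)
    then show "y \<in> Q n"
      using kp conj[OF PG] unfolding Q_def set_mult_def by blast
  next
    fix y assume "y \<in> Q n"
    then obtain k p where kp: "k \<in> K" "p \<in> P n" "y = p \<otimes> k"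
      by (auto simp: Q_def set_mult_def)
    then have "y = (p \<otimes> k \<otimes> inv p) \<otimes> p"
      using PG[of p n] by (simp add: m_assoc)
    then show "y \<in> K <#> P n"
      using kp conj'[OF PG] by (auto simp: set_mult_def)
  qed
  have QG: "Q n \<subseteq> carrier G" for n
    unfolding Q_def by (intro set_mult_closed P(1) K.subset)
  have Q1: "\<one> \<in> Q n" for n
  proof -
    have "\<one> \<otimes> \<one> \<in> Q n"
      using P(2)[of n] K.one_closed unfolding Q_def set_mult_def by blast
    then show ?thesis by simp
  qed
  have Q_inv: "inv q \<in> Q n" if q: "q \<in> Q n" for q n
  proof -
    obtain p k where pk: "p \<in> P n" "k \<in> K" "q = p \<otimes> k"
      using q by (auto simp: Q_def set_mult_def)
    then have "inv q = inv k \<otimes> inv p"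
      using PG by (simp add: inv_mult_group)
    then show ?thesis
      using P(3)[OF pk(1)] pk(2) by (auto simp: set_mult_def simp flip: KP)
  qed
  have Q_mult: "q \<otimes> q' \<in> Q n" if q: "q \<in> Q (Suc n)" "q' \<in> Q (Suc n)" for q q' n
  proof -
    obtain p k where pk: "p \<in> P (Suc n)" "k \<in> K" "q = p \<otimes> k"
      using q(1) by (auto simp: Q_def set_mult_def)
    obtain p' k' where pk': "p' \<in> P (Suc n)" "k' \<in> K" "q' = p' \<otimes> k'"
      using q(2) by (auto simp: Q_def set_mult_def)
    have G: "p \<in> carrier G" "p' \<in> carrier G" "k \<in> carrier G" "k' \<in> carrier G"
      using pk pk' PG by auto
    have "p' \<otimes> (inv p' \<otimes> k \<otimes> p') = k \<otimes> p'"
      using G by (simp flip: m_assoc)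
    then have "q \<otimes> q' = (p \<otimes> p') \<otimes> ((inv p' \<otimes> k \<otimes> p') \<otimes> k')"
      using G unfolding pk(3) pk'(3) by (metis conj K.mem_carrier m_assoc m_closed pk(2))
    moreover have "(inv p' \<otimes> k \<otimes> p') \<otimes> k' \<in> K"
      using conj[OF G(2) pk(2)] pk'(2) by simp
    ultimately show ?thesis
      using P(4)[OF pk(1) pk'(1)] by (auto simp: Q_def set_mult_def)
  qed
  have Q_Suc: "Q (Suc n) \<subseteq> Q n" for n
  proof
    fix q assume q: "q \<in> Q (Suc n)"
    with Q_mult[OF q Q1] QG show "q \<in> Q n"
      by (metis r_one subsetD)
  qed
  have Q_K: "q \<otimes> k \<in> Q n" if "q \<in> Q n" "k \<in> K" for q k n
  proof -
    obtain p l where "p \<in> P n" "l \<in> K" "q = p \<otimes> l"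
      using \<open>q \<in> Q n\<close> by (auto simp: Q_def set_mult_def)
    then show ?thesis
      using that(2) PG by (auto simp: Q_def set_mult_def m_assoc)
  qed
  have measQ: "Z <#> Q n \<in> sets N" if "Z \<subseteq> carrier G" for Z n
  proof -
    \<comment> \<open>\<open>Q n\<close> is also \<open>K <#> P n\<close>, so \<open>K\<close> can
      be absorbed into the arbitrary left factor.\<close>
    have "Z <#> Q n = (Z <#> K) <#> P n"
      using that K.subset P(1) by (simp add: set_mult_assoc KP)
    also have "\<dots> \<in> sets N"
      using that K.subset by (intro meas set_mult_closed)
    finally show ?thesis .
  qed
  have Q0: "Q 0 \<in> null_sets N"
    using null0 by (simp add: Q_def K_def)

  \<comment> \<open>\<open>B\<close> is a null neighbourhood of \<open>1\<close>, open for the topology with neighbourhoods \<open>x Q n\<close>.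
    The sets \<open>A n x\<close> are its translates, cut down and fattened as in Stone's proof.\<close>
  define B where "B = {y \<in> carrier G. \<exists>n. \<forall>q\<in>Q n. y \<otimes> q \<in> Q 0}"
  have B_sub: "B \<subseteq> Q 0"
  proof
    fix y assume "y \<in> B"
    then obtain n where "y \<in> carrier G" "\<forall>q\<in>Q n. y \<otimes> q \<in> Q 0"
      by (auto simp: B_def)
    then show "y \<in> Q 0"
      using Q1[of n] by force
  qed
  have B1: "\<one> \<in> B"
    using QG[of 0] by (auto simp: B_def intro!: exI[of _ 0])
  have B_open: "\<exists>n. \<forall>q\<in>Q n. y \<otimes> q \<in> B" if y: "y \<in> B" for y
  proof -
    obtain n where n: "y \<in> carrier G" "\<forall>q\<in>Q n. y \<otimes> q \<in> Q 0"
      using y by (auto simp: B_def)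
    have "y \<otimes> q \<in> B" if q: "q \<in> Q (Suc n)" for q
    proof -
      have qG: "q \<in> carrier G" using q QG by blast
      have "(y \<otimes> q) \<otimes> q' \<in> Q 0" if q': "q' \<in> Q (Suc n)" for q'
      proof -
        have "q' \<in> carrier G" using q' QG by blast
        then have "(y \<otimes> q) \<otimes> q' = y \<otimes> (q \<otimes> q')"
          using n(1) qG by (simp add: m_assoc)
        then show ?thesis
          using n(2) Q_mult[OF q q'] by simp
      qed
      then show ?thesis
        using n(1) qG by (auto simp: B_def intro!: exI[of _ "Suc n"])
    qed
    then show ?thesis by blast
  qed

  obtain r :: "'a rel" where r: "well_order_on UNIV r"
    using well_order_on by blast
  define lt where "lt x y \<longleftrightarrow> (x, y) \<in> r - Id" for x y
  have wf: "wf (r - Id)"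
    using r by (simp add: well_order_on_def)
  have tot: "lt x y \<or> x = y \<or> lt y x" for x y
    using r by (auto simp: well_order_on_def linear_order_on_def total_on_def lt_def)
  \<comment> \<open>The gap between \<open>Q n\<close> here and \<open>Q (Suc n)\<close> in
    \<open>A\<close> pays for disjointness: two points whose fattenings meet differ by an element of
    \<open>Q n\<close>. The fattening gives the subunions the form for which \<open>measQ\<close>
    yields measurability.\<close>
  define E where "E n x = {y \<in> carrier G. (\<forall>q\<in>Q n. inv x \<otimes> (y \<otimes> q) \<in> B) \<and>
    (\<forall>z\<in>carrier G. lt z x \<longrightarrow> inv z \<otimes> y \<notin> B)}" for n x
  define A where "A n x = E n x <#> Q (Suc n)" for n x
  have EG: "E n x \<subseteq> carrier G" for n x
    by (auto simp: E_def)
  have A_UN: "(\<Union>x\<in>J. A n x) = (\<Union>x\<in>J. E n x) <#> Q (Suc n)" for n J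
    by (auto simp: A_def set_mult_def)

  have not_lt: "\<not> lt z x" if u: "u \<in> A n x" "u \<in> A n z" and zG: "z \<in> carrier G" for n u x z
  proof
    assume "lt z x"
    obtain y q where y: "y \<in> E n x" "q \<in> Q (Suc n)" "u = y \<otimes> q"
      using u(1) by (auto simp: A_def set_mult_def)
    obtain y' q' where y': "y' \<in> E n z" "q' \<in> Q (Suc n)" "u = y' \<otimes> q'"
      using u(2) by (auto simp: A_def set_mult_def)
    have G: "y \<in> carrier G" "q \<in> carrier G" "y' \<in> carrier G" "q' \<in> carrier G"
      using y y' QG EG by blast+
    have "y = y' \<otimes> (q' \<otimes> inv q)"
      using y(3) y'(3) G by (metis inv_closed inv_solve_right m_assoc m_closed)
    moreover have "q' \<otimes> inv q \<in> Q n"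
      using Q_mult[OF y'(2) Q_inv[OF y(2)]] .
    ultimately have "inv z \<otimes> y \<in> B"
      using y'(1) by (auto simp: E_def)
    then show False
      using y(1) zG \<open>lt z x\<close> by (auto simp: E_def)
  qed
  have disj: "disjoint_family_on (A n) (carrier G)" for n
    unfolding disjoint_family_on_def using not_lt tot by (meson disjoint_iff)
  have null: "A n x \<in> null_sets N" if x: "x \<in> carrier G" for n x
  proof -
    have "A n x \<subseteq> (\<lambda>w. x \<otimes> w) ` Q 0"
    proof
      fix u assume "u \<in> A n x"
      then obtain y q where y: "y \<in> E n x" "q \<in> Q (Suc n)" "u = y \<otimes> q"
        by (auto simp: A_def set_mult_def)
      then have uG: "u \<in> carrier G"
        using QG EG by (metis m_closed subsetD)
      have "inv x \<otimes> u \<in> Q 0"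
        using y Q_Suc B_sub by (auto simp: E_def)
      then show "u \<in> (\<lambda>w. x \<otimes> w) ` Q 0"
        using x uG QG by (simp add: mult_image_eq)
    qed
    then show ?thesis
      using null_translate[OF x Q0] by (rule null_sets_completion_subset)
  qed
  have covers: "(\<Union>n. \<Union>x\<in>carrier G. A n x) = carrier G"
  proof (intro equalityI subsetI)
    fix y assume "y \<in> carrier G"
    then have "y \<in> {x \<in> carrier G. inv x \<otimes> y \<in> B}"
      using B1 by simp
    \<comment> \<open>Since \<open>y\<close> itself is a candidate, a first centre \<open>x\<close>
      exists; openness of \<open>B\<close> then provides the level \<open>n\<close> at which
      \<open>y\<close> still fits.\<close>
    from wfE_min[OF wf this] obtain x where x: "x \<in> carrier G" "inv x \<otimes> y \<in> B"
      and min: "\<And>z. lt z x \<Longrightarrow> z \<notin> {x \<in> carrier G. inv x \<otimes> y \<in> B}"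
      by (auto simp: lt_def)
    obtain n where n: "\<forall>q\<in>Q n. (inv x \<otimes> y) \<otimes> q \<in> B"
      using B_open[OF x(2)] by blast
    have "inv x \<otimes> (y \<otimes> q) \<in> B" if "q \<in> Q n" for q
    proof -
      have "q \<in> carrier G" using that QG by blast
      then have "(inv x \<otimes> y) \<otimes> q = inv x \<otimes> (y \<otimes> q)"
        using x(1) \<open>y \<in> carrier G\<close> by (simp add: m_assoc)
      then show ?thesis
        using n that by metis
    qed
    then have "y \<in> E n x"
      using min \<open>y \<in> carrier G\<close> by (auto simp: E_def)
    then have "y \<in> A n x"
      using Q1[of "Suc n"] \<open>y \<in> carrier G\<close> by (force simp: A_def set_mult_def)
    then show "y \<in> (\<Union>n. \<Union>x\<in>carrier G. A n x)"
      using x(1) by blast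
  next
    fix y assume "y \<in> (\<Union>n. \<Union>x\<in>carrier G. A n x)"
    then show "y \<in> carrier G"
      using set_mult_closed[OF EG QG] by (auto simp: A_def)
  qed

  obtain \<B> where \<B>: "countable \<B>" "\<And>B. B \<in> \<B> \<Longrightarrow> openin T B"
    "\<And>x O'. x \<in> carrier G \<Longrightarrow> openin T O' \<Longrightarrow> (\<And>k. k \<in> K \<Longrightarrow> x \<otimes> k \<in> O')
      \<Longrightarrow> \<exists>B\<in>\<B>. x \<in> B \<and> B \<subseteq> O'"
    using countable_saturated_base[OF V K_def compact_Y Union_Y] by metis
  have "(\<Union>x\<in>carrier G. A n x) \<in> null_sets N" for n
  proof (rule null_Union_of_measurable_subunions[OF sigma_finite_completion \<B>(1) _ disj])
    show "\<B> \<subseteq> sets N"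
      using \<B>(2) open_sets by auto
    show "(\<Union>x\<in>J. A n x) \<in> sets N" for J
      unfolding A_UN using EG by (intro measQ) auto
    fix J and e :: ennreal
    let ?L = "\<Union>x\<in>J. A n x"
    assume J: "J \<subseteq> carrier G" "?L \<in> null_sets N" "0 < e"
    then obtain C where "C \<in> null_sets M" "?L \<subseteq> C"
      unfolding null_sets_completion_iff2 by auto
    moreover from this obtain U where "openin T U" "C \<subseteq> U" "emeasure M U < e"
      using outer_nbhd[of C e] J(3) by (metis null_setsD1 null_setsD2)
    ultimately have U: "openin T U" "?L \<subseteq> U" "emeasure M U < e"
      by auto
    \<comment> \<open>The countable collection is a base only at points whose whole coset of
      \<open>K\<close> lies in \<open>U\<close>; the points of \<open>?L\<close> qualify, because
      \<open>?L\<close> is a union of such cosets.\<close>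
    define \<C> where "\<C> = {B \<in> \<B>. B \<subseteq> U}"
    have "?L \<subseteq> \<Union>\<C>"
    proof
      fix u assume u: "u \<in> ?L"
      then obtain x y q where y: "x \<in> J" "y \<in> E n x" "q \<in> Q (Suc n)" "u = y \<otimes> q"
        by (auto simp: A_def set_mult_def)
      have G: "y \<in> carrier G" "q \<in> carrier G"
        using y QG EG by blast+
      have "u \<otimes> k \<in> U" if "k \<in> K" for k
      proof -
        have "u \<otimes> k = y \<otimes> (q \<otimes> k)"
          using that y(4) G by (simp add: m_assoc)
        then have "u \<otimes> k \<in> ?L"
          using Q_K[OF y(3) that] y by (auto simp: A_def set_mult_def)
        then show ?thesis using U(2) by blast
      qed
      then have "\<exists>B\<in>\<B>. u \<in> B \<and> B \<subseteq> U"
        using G y(4) U(1) by (intro \<B>(3)) auto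
      then show "u \<in> \<Union>\<C>"
        by (auto simp: \<C>_def)
    qed
    moreover have "emeasure N (\<Union>\<C>) \<le> emeasure N U"
      using open_sets[OF U(1)] by (intro emeasure_mono) (auto simp: \<C>_def)
    ultimately show "\<exists>\<C>\<subseteq>\<B>. ?L \<subseteq> \<Union>\<C> \<and> emeasure N (\<Union>\<C>) < e"
      using U open_sets[OF U(1)] by (intro exI[of _ \<C>]) (auto simp: \<C>_def)
  qed (rule null)
  then have "(\<Union>n. \<Union>x\<in>carrier G. A n x) \<in> null_sets N"
    by (intro null_sets_UN)
  then have "carrier G \<in> null_sets N"
    by (simp add: covers)
  then show False
    using nonnull unfolding null_sets_completion_iff2 by (metis emeasure_eq_0 null_setsD1 null_setsD2)
qed

end

section \<open>Reduction to an open sigma-compact subgroup\<close>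

lemma (in top_group) compactin_set_mult:
  assumes "compactin T C" "compactin T D"
  shows "compactin T (C <#> D)"
proof -
  have "continuous_map (prod_topology T T) T (\<lambda>(x, y). x \<otimes> y)"
    using topological_group by (simp add: topological_group_def)
  moreover have "compactin (prod_topology T T) (C \<times> D)"
    using assms by (simp add: compactin_Times)
  ultimately have "compactin T ((\<lambda>(x, y). x \<otimes> y) ` (C \<times> D))"
    by (rule image_compactin[rotated])
  moreover have "(\<lambda>(x, y). x \<otimes> y) ` (C \<times> D) = C <#> D"
    by (auto simp: set_mult_def)
  ultimately show ?thesis by simp
qed

text \<open>The subgroup generated by a compact neighbourhood of 1 is a union of compact powers, and
  it is open because it contains a neighbourhood of 1.\<close>

lemma (in top_group) sigma_compact_open_subgroup:
  assumes "locally_compact_space T"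
  obtains X :: "'a set" and Y :: "nat \<Rightarrow> 'a set" where
    "subgroup X G" "openin T X" "\<And>n. compactin T (Y n)" "(\<Union>n. Y n) = X"
proof -
  obtain U C where U: "openin T U" "compactin T C" "\<one> \<in> U" "U \<subseteq> C"
    using assms[unfolded locally_compact_space_def, rule_format, of \<one>] by auto
  \<comment> \<open>Squaring, rather than adding one factor at a time, puts the product of two
    elements of \<open>Y n\<close> directly into \<open>Y (Suc n)\<close>.\<close>
  define Y where "Y = rec_nat (C \<union> (\<lambda>x. inv x) ` C) (\<lambda>_ S. S <#> S)"
  have Y0: "Y 0 = C \<union> (\<lambda>x. inv x) ` C" and Y_Suc: "Y (Suc n) = Y n <#> Y n" for n
    by (simp_all add: Y_def)
  have "compactin T ((\<lambda>x. inv x) ` C)"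
    using U(2) continuous_map_m_inv[OF continuous_map_idI] by (rule image_compactin)
  then have comp: "compactin T (Y n)" for n
    by (induction n) (use U(2) in \<open>auto simp: Y0 Y_Suc intro: compactin_Un compactin_set_mult\<close>)
  have YG: "Y n \<subseteq> carrier G" for n
    using compactin_subset_carrier[OF comp] .
  have one: "\<one> \<in> Y n" for n
  proof (induction n)
    case (Suc n)
    then show ?case unfolding Y_Suc set_mult_def by force
  qed (use U in \<open>auto simp: Y0\<close>)
  have inv: "x \<in> Y n \<Longrightarrow> inv x \<in> Y n" for x n
  proof (induction n arbitrary: x)
    case 0
    then show ?case
      using compactin_subset_carrier[OF U(2)] by (auto simp: Y0)
  next
    case (Suc n)
    then obtain a b where ab: "a \<in> Y n" "b \<in> Y n" "x = a \<otimes> b"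
      by (auto simp: Y_Suc set_mult_def)
    then have "inv x = inv b \<otimes> inv a"
      using YG[of n] by (auto intro!: inv_mult_group)
    then show ?case
      using Suc.IH ab by (auto simp: Y_Suc set_mult_def)
  qed
  have "Y n \<subseteq> Y (Suc n)" for n
  proof
    fix x assume "x \<in> Y n"
    moreover from this have "x = x \<otimes> \<one>" using YG[of n] by auto
    ultimately show "x \<in> Y (Suc n)"
      using one[of n] unfolding Y_Suc set_mult_def by blast
  qed
  then have mono: "m \<le> n \<Longrightarrow> Y m \<subseteq> Y n" for m n
    by (rule lift_Suc_antimono_le[where f = "\<lambda>n. - Y n", simplified])
  define X where "X = (\<Union>n. Y n)"
  have sub: "subgroup X G"
  proof
    show "X \<subseteq> carrier G" using YG by (auto simp: X_def)
    show "\<one> \<in> X" using one by (auto simp: X_def)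
    show "inv x \<in> X" if "x \<in> X" for x using that inv by (auto simp: X_def)
    fix x y assume "x \<in> X" "y \<in> X"
    then obtain m n where "x \<in> Y m" "y \<in> Y n" by (auto simp: X_def)
    then have "x \<in> Y (max m n)" "y \<in> Y (max m n)"
      using mono[of m "max m n"] mono[of n "max m n"] by auto
    then have "x \<otimes> y \<in> Y (Suc (max m n))"
      by (auto simp: Y_Suc set_mult_def)
    then show "x \<otimes> y \<in> X" by (auto simp: X_def)
  qed
  interpret X: subgroup X G by (rule sub)
  have "U \<subseteq> X"
    using U(4) Y0 by (auto simp: X_def)
  have "X = (\<Union>x\<in>X. (\<lambda>u. x \<otimes> u) ` U)"
  proof (intro equalityI subsetI)
    fix x assume "x \<in> X"
    then show "x \<in> (\<Union>x\<in>X. (\<lambda>u. x \<otimes> u) ` U)"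
      using U(3) X.subset by (intro UN_I[of x] image_eqI[of _ _ \<one>]) auto
  qed (use \<open>U \<subseteq> X\<close> X.m_closed in auto)
  moreover have "openin T (\<Union>x\<in>X. (\<lambda>u. x \<otimes> u) ` U)"
    using U(1) X.subset by (intro openin_clauses(3)) (auto intro: openin_mult_image)
  ultimately have "openin T X" by simp
  then show thesis
    using that[OF sub _ comp] by (simp add: X_def)
qed

lemma (in top_group) topological_group_subgroup:
  assumes "subgroup X G"
  shows "topological_group (G\<lparr>carrier := X\<rparr>) (subtopology T X)"
  unfolding topological_group_def
proof (intro conjI)
  interpret X: subgroup X G by fact
  show "group (G\<lparr>carrier := X\<rparr>)"
    by (rule X.subgroup_is_group[OF is_group])
  show "topspace (subtopology T X) = carrier (G\<lparr>carrier := X\<rparr>)"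
    using X.subset by auto
  show "Hausdorff_space (subtopology T X)"
    by (rule Hausdorff_space_subtopology[OF Hausdorff])
  have "continuous_map (prod_topology T T) T (\<lambda>(x, y). x \<otimes> y)"
    using topological_group by (simp add: topological_group_def)
  then show "continuous_map (prod_topology (subtopology T X) (subtopology T X)) (subtopology T X)
      (\<lambda>(x, y). x \<otimes>\<^bsub>G\<lparr>carrier := X\<rparr>\<^esub> y)"
    unfolding subtopology_Times[symmetric]
    by (intro continuous_map_into_subtopology)
      (auto intro: continuous_map_from_subtopology)
  have "continuous_map (subtopology T X) (subtopology T X) (\<lambda>x. inv x)"
    using continuous_map_m_inv[OF continuous_map_idI] X.m_inv_closed
    by (intro continuous_map_into_subtopology) (auto intro: continuous_map_from_subtopology)
  then show "continuous_map (subtopology T X) (subtopology T X) (\<lambda>x. inv\<^bsub>G\<lparr>carrier := X\<rparr>\<^esub> x)"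
    by (rule continuous_map_eq) (use assms in auto)
qed

section \<open>Haar measure restricted to an open subgroup\<close>

lemma haar_measurable_sets_completion:
  assumes "sets M = borel_sets_of T" "space M = topspace T"
  shows "haar_measurable_sets T M \<subseteq> sets (completion M)"
proof -
  have "sigma_sets (space (completion M)) (borel_sets_of T \<union> {N. N \<subseteq> topspace T \<and> haar_null T M N})
      \<subseteq> sets (completion M)"
    using assms by (intro sets.sigma_sets_subset) (auto simp: haar_null_def intro: sets_completionI_sub)
  then show ?thesis
    by (simp add: haar_measurable_sets_def assms)
qed

lemma sets_completion_restrict_space:
  assumes "A \<in> sets (completion M)" "X \<in> sets M"
  shows "A \<inter> X \<in> sets (completion (restrict_space M X))"
proof -
  obtain S N N' where "A = S \<union> N" "N \<subseteq> N'" "N' \<in> null_sets M" "S \<in> sets M"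
    using assms(1) by (rule sets_completionE)
  with assms(2) show ?thesis
    by (intro sets_completionI[of _ "S \<inter> X" "N \<inter> X" "N' \<inter> X"])
      (auto simp: null_sets_restrict_space sets_restrict_space intro: null_set_Int2)
qed

text \<open>Openness of \<open>X\<close> is what transfers outer regularity: an open
  \<open>U\<close> around \<open>A\<close> may be replaced by its intersection with
  \<open>X\<close>, which is open in both topologies.\<close>

lemma left_haar_open_subgroup:
  assumes G: "topological_group G T" and lc: "locally_compact_space T" and M: "haar_measure G T M"
    and X: "subgroup X G" "openin T X" and Y: "\<And>n. compactin T (Y n)" "(\<Union>n. Y n) = X"
  shows "left_haar (G\<lparr>carrier := X\<rparr>) (subtopology T X) (restrict_space M X) Y"
proof -
  interpret top_group G T
    using G by (rule top_group_if_topological_group)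
  interpret X: subgroup X G by fact
  have spM: "space M = carrier G" and stM: "sets M = borel_sets_of T"
    and fin: "compactin T C \<Longrightarrow> emeasure M C < \<infinity>"
    and outer: "A \<in> sets M \<Longrightarrow> emeasure M A = (INF U\<in>{U. openin T U \<and> A \<subseteq> U}. emeasure M U)"
    and left: "g \<in> carrier G \<Longrightarrow> A \<in> sets M \<Longrightarrow>
      (\<lambda>x. g \<otimes>\<^bsub>G\<^esub> x) ` A \<in> sets M \<and> emeasure M ((\<lambda>x. g \<otimes>\<^bsub>G\<^esub> x) ` A) = emeasure M A" for A C g
    using M unfolding haar_measure_def topspace_eq by blast+
  have XM: "X \<in> sets M"
    using X(2) by (auto simp: stM borel_sets_of_def)
  have open_sets: "openin T U \<Longrightarrow> U \<in> sets M" for U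
    by (auto simp: stM borel_sets_of_def)
  have em: "A \<subseteq> X \<Longrightarrow> emeasure (restrict_space M X) A = emeasure M A" for A
    using XM by (intro emeasure_restrict_space) auto
  have st: "A \<in> sets (restrict_space M X) \<longleftrightarrow> A \<in> sets M \<and> A \<subseteq> X" for A
    using XM by (simp add: sets_restrict_space_iff Int_absorb2 sets.sets_into_space conj_commute)
  show ?thesis
  proof (intro left_haar.intro left_haar_axioms.intro top_group.intro top_group_axioms.intro)
    show "group (G\<lparr>carrier := X\<rparr>)"
      by (rule X.subgroup_is_group[OF is_group])
    show "topological_group (G\<lparr>carrier := X\<rparr>) (subtopology T X)"
      by (rule topological_group_subgroup[OF X(1)])
    show "locally_compact_space (subtopology T X)"
      using lc X(2) Hausdorff by (intro locally_compact_space_open_subset) auto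
    show "compactin (subtopology T X) (Y n)" for n
      using Y by (auto simp: compactin_subtopology)
    show "(\<Union>n. Y n) = carrier (G\<lparr>carrier := X\<rparr>)"
      using Y(2) by simp
    show "space (restrict_space M X) = carrier (G\<lparr>carrier := X\<rparr>)"
      using X.subset by (simp add: space_restrict_space spM Int_absorb2)
    have "sets (restrict_space M X) = (\<inter>) X ` sigma_sets (carrier G) {U. openin T U}"
      by (simp add: sets_restrict_space stM borel_sets_of_def)
    also have "\<dots> = sigma_sets X ((\<inter>) X ` {U. openin T U})"
      using X.subset X(2) by (intro sigma_sets_Int) auto
    also have "(\<inter>) X ` {U. openin T U} = {U. openin (subtopology T X) U}"
      by (auto simp: openin_subtopology Int_commute)
    finally show "sets (restrict_space M X) = borel_sets_of (subtopology T X)"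
      using X.subset by (simp add: borel_sets_of_def Int_absorb1)
    show "emeasure (restrict_space M X) C < \<infinity>" if "compactin (subtopology T X) C" for C
      using that fin by (simp add: compactin_subtopology em)
    show "(\<lambda>x. g \<otimes>\<^bsub>G\<lparr>carrier := X\<rparr>\<^esub> x) ` A \<in> sets (restrict_space M X) \<and>
        emeasure (restrict_space M X) ((\<lambda>x. g \<otimes>\<^bsub>G\<lparr>carrier := X\<rparr>\<^esub> x) ` A) = emeasure (restrict_space M X) A"
      if "g \<in> carrier (G\<lparr>carrier := X\<rparr>)" "A \<in> sets (restrict_space M X)" for g A
    proof -
      have gA: "g \<in> X" "A \<subseteq> X" "A \<in> sets M"
        using that by (auto simp: st)
      then have "(\<lambda>x. g \<otimes>\<^bsub>G\<^esub> x) ` A \<subseteq> X" by auto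
      then show ?thesis
        using left[of g A] gA X.subset by (auto simp: st em)
    qed
    show "emeasure (restrict_space M X) A =
        (INF U\<in>{U. openin (subtopology T X) U \<and> A \<subseteq> U}. emeasure (restrict_space M X) U)"
      if "A \<in> sets (restrict_space M X)" for A
    proof (rule antisym)
      have A: "A \<subseteq> X" "A \<in> sets M"
        using that by (auto simp: st)
      show "emeasure (restrict_space M X) A \<le>
          (INF U\<in>{U. openin (subtopology T X) U \<and> A \<subseteq> U}. emeasure (restrict_space M X) U)"
        by (intro INF_greatest emeasure_mono)
          (auto simp: st openin_open_subtopology[OF X(2)] intro: open_sets)
      have "(INF U\<in>{U. openin (subtopology T X) U \<and> A \<subseteq> U}. emeasure (restrict_space M X) U)
          \<le> (INF U\<in>{U. openin T U \<and> A \<subseteq> U}. emeasure M U)"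
      proof (rule INF_mono)
        fix U assume "U \<in> {U. openin T U \<and> A \<subseteq> U}"
        then have U: "openin T U" "A \<subseteq> U" by auto
        show "\<exists>V\<in>{U. openin (subtopology T X) U \<and> A \<subseteq> U}.
            emeasure (restrict_space M X) V \<le> emeasure M U"
        proof (rule bexI[of _ "U \<inter> X"])
          show "emeasure (restrict_space M X) (U \<inter> X) \<le> emeasure M U"
            using U open_sets by (auto simp: em intro: emeasure_mono)
        qed (use U A X(2) in \<open>auto simp: openin_open_subtopology\<close>)
      qed
      then show "(INF U\<in>{U. openin (subtopology T X) U \<and> A \<subseteq> U}. emeasure (restrict_space M X) U)
          \<le> emeasure (restrict_space M X) A"
        using A outer[of A] by (simp add: em)
    qed
  qed
qed

text \<open>A compact set is covered by finitely many left cosets of \<open>X\<close>. If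
  \<open>X\<close> were null, all compact sets would be null, and inner regularity on the open set
  \<open>carrier G\<close> would make the whole group null.\<close>

lemma haar_open_subgroup_nonnull:
  assumes G: "topological_group G T" and M: "haar_measure G T M"
    and X: "subgroup X G" "openin T X"
  shows "emeasure M X \<noteq> 0"
proof
  assume null: "emeasure M X = 0"
  interpret top_group G T
    using G by (rule top_group_if_topological_group)
  interpret X: subgroup X G by fact
  have stM: "sets M = borel_sets_of T"
    and inner: "openin T U \<Longrightarrow> emeasure M U = (SUP K\<in>{K. compactin T K \<and> K \<subseteq> U}. emeasure M K)"
    and nonnull: "emeasure M (carrier G) \<noteq> 0"
    and left: "g \<in> carrier G \<Longrightarrow> A \<in> sets M \<Longrightarrow>
      (\<lambda>x. g \<otimes>\<^bsub>G\<^esub> x) ` A \<in> sets M \<and> emeasure M ((\<lambda>x. g \<otimes>\<^bsub>G\<^esub> x) ` A) = emeasure M A" for A U g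
    using M unfolding haar_measure_def topspace_eq by blast+
  have XM: "X \<in> sets M"
    using X(2) by (auto simp: stM borel_sets_of_def)
  let ?\<U> = "(\<lambda>x. (\<lambda>u. x \<otimes>\<^bsub>G\<^esub> u) ` X) ` carrier G"
  have "emeasure M C = 0" if C: "compactin T C" for C
  proof -
    have "C \<subseteq> \<Union>?\<U>"
    proof
      fix x assume "x \<in> C"
      then have "x \<in> carrier G"
        using compactin_subset_carrier[OF C] by blast
      then show "x \<in> \<Union>?\<U>"
        by (intro UnionI[of "(\<lambda>u. x \<otimes>\<^bsub>G\<^esub> u) ` X"] image_eqI[of x _ "\<one>\<^bsub>G\<^esub>"]) auto
    qed
    moreover have "openin T U" if "U \<in> ?\<U>" for U
      using that X(2) by (auto intro: openin_mult_image)
    ultimately obtain \<F> where \<F>: "finite \<F>" "\<F> \<subseteq> ?\<U>" "C \<subseteq> \<Union>\<F>"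
      using compactinD[OF C, of ?\<U>] by blast
    have "(\<Union>U\<in>\<F>. U) \<in> null_sets M"
      using \<F>(1,2) left[OF _ XM] null by (intro null_sets.finite_UN) (auto simp: null_sets_def)
    then show ?thesis
      using \<F>(3) by (metis emeasure_eq_0 image_ident null_setsD1 null_setsD2)
  qed
  then have "(SUP K\<in>{K. compactin T K \<and> K \<subseteq> carrier G}. emeasure M K) \<le> 0"
    by (intro SUP_least) simp
  then have "emeasure M (carrier G) \<le> 0"
    using inner[of "carrier G"] openin_topspace[of T] by simp
  then show False
    using nonnull by simp
qed

theorem theorem1p1:
  fixes G :: "('a, 'm) monoid_scheme" and H :: "('b, 'n) monoid_scheme"
    and TX :: "'a topology" and TY :: "'b topology"
    and M :: "'a measure" and h :: "'a \<Rightarrow> 'b"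
  assumes "topological_group G TX" and "locally_compact_space TX"
    and "topological_group H TY"
    and "haar_measure G TX M"
    and "h \<in> hom G H"
    and "haar_measurable_fun TX M TY h"
  shows "continuous_map TX TY h"
proof -
  interpret G: top_group G TX
    using assms(1) by (rule top_group_if_topological_group)
  interpret H: top_group H TY
    using assms(3) by (rule top_group_if_topological_group)
  interpret h: group_hom G H h
    using assms(5) by (simp add: group_hom_def group_hom_axioms_def G.is_group H.is_group)
  obtain X and Y :: "nat \<Rightarrow> 'a set" where X: "subgroup X G" "openin TX X"
    and Y: "\<And>n. compactin TX (Y n)" "(\<Union>n. Y n) = X"
    by (rule G.sigma_compact_open_subgroup[OF assms(2)]) blast
  interpret X: subgroup X G by fact
  let ?G = "G\<lparr>carrier := X\<rparr>"
  interpret L: left_haar ?G "subtopology TX X" "restrict_space M X" Y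
    by (rule left_haar_open_subgroup[OF assms(1,2,4) X Y])
  have spM: "space M = topspace TX" and stM: "sets M = borel_sets_of TX"
    using assms(4) by (simp_all add: haar_measure_def)
  have XM: "X \<in> sets M"
    using X(2) by (auto simp: stM borel_sets_of_def)
  have meas: "{x \<in> X. h x \<in> U} \<in> sets (completion (restrict_space M X))" if "openin TY U" for U
  proof -
    have eq: "{x \<in> topspace TX. h x \<in> U} \<inter> X = {x \<in> X. h x \<in> U}"
      using X.subset by auto
    have "{x \<in> topspace TX. h x \<in> U} \<in> haar_measurable_sets TX M"
      using assms(6) that unfolding haar_measurable_fun_def by simp
    then have "{x \<in> topspace TX. h x \<in> U} \<in> sets (completion M)"
      by (rule subsetD[OF haar_measurable_sets_completion[OF stM spM]])
    from sets_completion_restrict_space[OF this XM] show ?thesis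
      unfolding eq .
  qed
  have near_one: "\<exists>V. openin TX V \<and> \<one>\<^bsub>G\<^esub> \<in> V \<and> h ` V \<subseteq> W" if W: "openin TY W" "\<one>\<^bsub>H\<^esub> \<in> W" for W
  proof -
    obtain A where A: "openin TY A" "\<one>\<^bsub>H\<^esub> \<in> A" "\<And>a b. a \<in> A \<Longrightarrow> b \<in> A \<Longrightarrow> a \<otimes>\<^bsub>H\<^esub> b \<in> W"
      using H.square_nbhd[OF W] by blast
    \<comment> \<open>With empty compact sets the conjugation clause is void; what remains is a
      chain inside \<open>A\<close>.\<close>
    obtain C where "H.nbhd_chain C" and CA: "C 0 \<subseteq> A"
      using H.nbhd_chain_exists[of "\<lambda>n::nat. {}" "\<lambda>n. A"] A(1,2) by (metis compactin_empty)
    note C = H.nbhd_chainD[OF this(1)]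
    define P where "P n = {x \<in> X. h x \<in> C n}" for n
    have nonnull: "P 0 \<notin> null_sets (completion (restrict_space M X))"
    proof (rule L.nbhd_sequence_not_null)
      show "P n \<subseteq> carrier ?G" "\<one>\<^bsub>?G\<^esub> \<in> P n" for n
        using C(2) by (auto simp: P_def)
      show "inv\<^bsub>?G\<^esub> p \<in> P n" if "p \<in> P n" for n p
        using that C(3) X by (auto simp: P_def)
      show "p \<otimes>\<^bsub>?G\<^esub> q \<in> P n" if "p \<in> P (Suc n)" "q \<in> P (Suc n)" for n p q
        using that C(4) by (auto simp: P_def)
      show "emeasure (restrict_space M X) (carrier ?G) \<noteq> 0"
        using haar_open_subgroup_nonnull[OF assms(1,4) X] XM by (simp add: emeasure_restrict_space)
      fix Z n assume "Z \<subseteq> carrier ?G"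
      then have Z: "Z \<subseteq> X" by simp
      let ?U = "\<Union>z\<in>Z. (\<lambda>c. h z \<otimes>\<^bsub>H\<^esub> c) ` C n"
      have "Z <#>\<^bsub>?G\<^esub> P n = {x \<in> X. h x \<in> ?U}"
      proof (intro equalityI subsetI)
        fix x assume "x \<in> Z <#>\<^bsub>?G\<^esub> P n"
        then obtain z p where "z \<in> Z" "p \<in> P n" "x = z \<otimes>\<^bsub>G\<^esub> p"
          by (auto simp: set_mult_def)
        then show "x \<in> {x \<in> X. h x \<in> ?U}"
          using Z by (auto simp: P_def subset_iff)
      next
        fix x assume "x \<in> {x \<in> X. h x \<in> ?U}"
        then obtain z c where x: "x \<in> X" "z \<in> Z" "c \<in> C n" "h x = h z \<otimes>\<^bsub>H\<^esub> c"
          by auto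
        have zX: "z \<in> X" "c \<in> carrier H"
          using x Z C(5) by auto
        have "h (inv\<^bsub>G\<^esub> z \<otimes>\<^bsub>G\<^esub> x) = c"
          using x zX by (simp flip: H.m_assoc)
        then have w: "inv\<^bsub>G\<^esub> z \<otimes>\<^bsub>G\<^esub> x \<in> P n"
          using x zX by (simp add: P_def)
        have "z \<otimes>\<^bsub>G\<^esub> (inv\<^bsub>G\<^esub> z \<otimes>\<^bsub>G\<^esub> x) \<in> Z <#>\<^bsub>?G\<^esub> P n"
          unfolding set_mult_def by (rule UN_I[OF x(2)], rule UN_I[OF w]) simp
        then show "x \<in> Z <#>\<^bsub>?G\<^esub> P n"
          using x zX by (simp flip: G.m_assoc)
      qed
      moreover have "openin TY ?U"
        using C(1) Z X.subset by (intro openin_clauses(3)) (auto intro!: H.openin_mult_image)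
      ultimately show "Z <#>\<^bsub>?G\<^esub> P n \<in> sets (completion (restrict_space M X))"
        using meas by (simp only:)
    qed
    have "P 0 \<in> sets (completion (restrict_space M X))"
      unfolding P_def by (rule meas[OF C(1)])
    from L.Steinhaus[OF this nonnull]
    obtain V where V: "openin (subtopology TX X) V" "\<one>\<^bsub>G\<^esub> \<in> V"
      and diff: "\<And>v. v \<in> V \<Longrightarrow> \<exists>a\<in>P 0. \<exists>b\<in>P 0. v = a \<otimes>\<^bsub>G\<^esub> inv\<^bsub>?G\<^esub> b"
      by auto
    \<comment> \<open>\<open>h\<close> maps \<open>P 0\<close> into \<open>C 0\<close>, which is
      symmetric and inside \<open>A\<close>; so it maps quotients of elements of \<open>P 0\<close>
      into \<open>W\<close>.\<close>
    have "h v \<in> W" if v: "v \<in> V" for v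
    proof -
      obtain a b where ab: "a \<in> P 0" "b \<in> P 0" "v = a \<otimes>\<^bsub>G\<^esub> inv\<^bsub>?G\<^esub> b"
        using diff[OF v] by blast
      then have "h v = h a \<otimes>\<^bsub>H\<^esub> inv\<^bsub>H\<^esub> h b"
        using X(1) by (simp add: P_def)
      also have "\<dots> \<in> W"
        using ab CA C(3) by (intro A(3)) (auto simp: P_def)
      finally show ?thesis .
    qed
    then show ?thesis
      using V openin_trans_full[OF V(1) X(2)] by blast
  qed
  show ?thesis
    unfolding continuous_map_def
  proof (intro conjI allI impI)
    show "h \<in> topspace TX \<rightarrow> topspace TY"
      by auto
    fix U assume U: "openin TY U"
    show "openin TX {x \<in> topspace TX. h x \<in> U}"
    proof (subst openin_subopen, intro ballI)
      fix x assume "x \<in> {x \<in> topspace TX. h x \<in> U}"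
      then have x: "x \<in> carrier G" "h x \<in> U" by auto
      let ?W = "{y \<in> carrier H. h x \<otimes>\<^bsub>H\<^esub> y \<in> U}"
      have "openin TY ?W" "\<one>\<^bsub>H\<^esub> \<in> ?W"
        using x U by (auto intro: H.openin_mult_preimage)
      from near_one[OF this] obtain V where V: "openin TX V" "\<one>\<^bsub>G\<^esub> \<in> V" "h ` V \<subseteq> ?W"
        by blast
      let ?N = "(\<lambda>v. x \<otimes>\<^bsub>G\<^esub> v) ` V"
      have "openin TX ?N" "x \<in> ?N"
        using V(1,2) x(1) by (auto intro!: G.openin_mult_image image_eqI[of _ _ "\<one>\<^bsub>G\<^esub>"])
      moreover have "?N \<subseteq> {x \<in> topspace TX. h x \<in> U}"
      proof clarify
        fix v assume v: "v \<in> V"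
        then have "h v \<in> ?W" "v \<in> carrier G"
          using V(3) G.openin_subset_carrier[OF V(1)] by blast+
        then show "x \<otimes>\<^bsub>G\<^esub> v \<in> topspace TX \<and> h (x \<otimes>\<^bsub>G\<^esub> v) \<in> U"
          using x(1) by simp
      qed
      ultimately show "\<exists>N. openin TX N \<and> x \<in> N \<and> N \<subseteq> {x \<in> topspace TX. h x \<in> U}"
        by blast
    qed
  qed
qed

end
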